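(* Let $\mathbf X=(X,\mathcal E)$ be a coarsely locally finite and coarsely countable coarse space, and let $\mathcal H_{\mathbf X}$ be a discrete $\mathbf X$-module. Let $X=\bigsqcup_{i\in I}A_i$ be a locally finite discrete partition for $\mathcal H_{\mathbf X}$. Let $\Lambda$ be the set of all functions $\lambda$ assigning to each $i\in I$ a finite-dimensional subspace $\lambda(i)\le\mathbb 1_{A_i}(\mathcal H_{\mathbf X})$, directed by $\lambda\le\lambda'$ iff $\lambda(i)\subseteq\lambda'(i)$ for all $i\in I$, and let $p_\lambda=\sum_{i\in I}p_{\lambda(i)}$ (strong sum), where $p_{\lambda(i)}$ is the orthogonal projection onto $\lambda(i)$. Then the net $(p_\lambda)_{\lambda\in\Lambda}\subseteq\mathbb C_{\mathrm{Roe}}[\mathcal H_{\mathbf X}]$ is an approximate unit of $C^*_{\mathrm{lc}}(\mathcal H_{\mathbf X})$.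
   Context: For relations $E,F\subseteq X\times X$: $E^T=\{(x,y):(y,x)\in E\}$, $E\circ F=\{(z,x):\exists y,(z,y)\in E,(y,x)\in F\}$, $E(A)=\{y:\exists a\in A,(y,a)\in E\}$; $B,A\subseteq X$ are $E$-separated if $B\cap E(A)=\emptyset$. A coarse structure on $X$ is a non-empty family $\mathcal E$ of subsets of $X\times X$, closed under subsets and finite unions, containing the diagonal $\Delta_X$, and closed under $E\mapsto E^T$ and composition. A gauge is a symmetric element of $\mathcal E$ containing $\Delta_X$. $A\subseteq X$ is $E$-bounded if $A\times A\subseteq E$, bounded if $A\times A\in\mathcal E$. A controlled partition is a partition of $X$ whose members are all $E$-bounded for a common $E\in\mathcal E$. A family of subsets is locally finite if every bounded set meets only finitely many members. $\mathbf X$ is coarsely locally finite if it admits a locally finite controlled partition; it is coarsely countable if it is coarsely equivalent to a coarse space on a countable set (equivalently, it admits a countable controlled partition). Here coarse spaces $(X,\mathcal E)$, $(Y,\mathcal F)$ are coarsely equivalent if there are functions $f\colon X\to Y$, $g\colon Y\to X$ with $(f\times f)(E)\in\mathcal F$ and $(g\times g)(F)\in\mathcal E$ for all $E\in\mathcal E$, $F\in\mathcal F$, and $\{(g(f(x)),x)\}\in\mathcal E$, $\{(f(g(y)),y)\}\in\mathcal F$. An $\mathbf X$-module consists of a Boolean algebra $\mathfrak A$ of subsets of $X$ with $X\in\mathfrak A$ (its members are called measurable), a Hilbert space $\mathcal H$, and a map $\mathbb 1_\bullet$ from $\mathfrak A$ to projections in $\mathcal B(\mathcal H)$ with $\mathbb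 1_\emptyset=0$, $\mathbb 1_X=1$, $\mathbb 1_{A\cap B}=\mathbb 1_A\mathbb 1_B$, $\mathbb 1_{A\cup B}=\mathbb 1_A+\mathbb 1_B-\mathbb 1_A\mathbb 1_B$, non-degenerate in the sense that for some gauge $\widetilde E$ the subspaces $\mathbb 1_A(\mathcal H)$ with $A$ measurable and $\widetilde E$-bounded span a dense subspace. A discrete partition is a partition $X=\bigsqcup_{i\in I}A_i$ into measurable sets, all $\widetilde E$-bounded for a common gauge $\widetilde E$, with $\sum_i\mathbb 1_{A_i}=1$ strongly, and such that every $C\subseteq X$ with $C\cap A_i\in\mathfrak A$ for all $i$ is in $\mathfrak A$. The module is discrete if a discrete partition exists. $t\in\mathcal B(\mathcal H)$ has controlled propagation if for some $E\in\mathcal E$, $\mathbb 1_Bt\mathbb 1_A=0$ for all $E$-separated measurable $B,A$; it is locally compact if $\mathbb 1_At$ and $t\mathbb 1_A$ are compact for every bounded measurable $A$. $C^*_{\mathrm{lc}}(\mathcal H)$ is the $C^*$-algebra of locally compact operators; $\mathbb C_{\mathrm{Roe}}[\mathcal H]$ is the $*$-algebra of locally compact operators of controlled propagation. *)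

theory Defs
  imports "HOL-Analysis.Analysis"
begin

section \<open>Coarse spaces\<close>

text \<open>With the convention that \<open>E \<circ> F\<close> consists of the pairs \<open>(z, x)\<close> with \<open>(z, y) \<in> E\<close> and
  \<open>(y, x) \<in> F\<close>, composition is \<^const>\<open>relcomp\<close> in the same order.\<close>

locale coarse_space =
  fixes X :: "'x set" and \<E> :: "('x \<times> 'x) set set"
  assumes sub_carrier: "\<E> \<subseteq> Pow (X \<times> X)"
    and nonempty: "\<E> \<noteq> {}"
    and subset_closed: "\<And>E F. E \<in> \<E> \<Longrightarrow> F \<subseteq> E \<Longrightarrow> F \<in> \<E>"
    and union_closed: "\<And>E F. E \<in> \<E> \<Longrightarrow> F \<in> \<E> \<Longrightarrow> E \<union> F \<in> \<E>"
    and diagonal: "Id_on X \<in> \<E>"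
    and transpose_closed: "\<And>E. E \<in> \<E> \<Longrightarrow> E\<inverse> \<in> \<E>"
    and comp_closed: "\<And>E F. E \<in> \<E> \<Longrightarrow> F \<in> \<E> \<Longrightarrow> E O F \<in> \<E>"

definition gauge_rel :: "'x set \<Rightarrow> ('x \<times> 'x) set set \<Rightarrow> ('x \<times> 'x) set \<Rightarrow> bool" where
  "gauge_rel X \<E> E \<longleftrightarrow> E \<in> \<E> \<and> sym E \<and> Id_on X \<subseteq> E"

definition rel_bounded :: "('x \<times> 'x) set \<Rightarrow> 'x set \<Rightarrow> bool" where
  "rel_bounded E A \<longleftrightarrow> A \<times> A \<subseteq> E"

definition coarsely_bounded :: "('x \<times> 'x) set set \<Rightarrow> 'x set \<Rightarrow> bool" where
  "coarsely_bounded \<E> A \<longleftrightarrow> A \<times> A \<in> \<E>"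

text \<open>\<open>E(A) = {y. \<exists>a\<in>A. (y, a) \<in> E}\<close> is the image of \<open>A\<close> under the converse of \<open>E\<close>.\<close>

definition separated :: "('x \<times> 'x) set \<Rightarrow> 'x set \<Rightarrow> 'x set \<Rightarrow> bool" where
  "separated E B A \<longleftrightarrow> B \<inter> (E\<inverse> `` A) = {}"

text \<open>Partitions are families indexed by a set \<open>I\<close>; empty members are allowed.\<close>

definition indexed_partition :: "'x set \<Rightarrow> 'i set \<Rightarrow> ('i \<Rightarrow> 'x set) \<Rightarrow> bool" where
  "indexed_partition X I A \<longleftrightarrow> disjoint_family_on A I \<and> (\<Union>i\<in>I. A i) = X"

definition controlled_partition ::
  "'x set \<Rightarrow> ('x \<times> 'x) set set \<Rightarrow> 'i set \<Rightarrow> ('i \<Rightarrow> 'x set) \<Rightarrow> bool" where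
  "controlled_partition X \<E> I A \<longleftrightarrow>
     indexed_partition X I A \<and> (\<exists>E\<in>\<E>. \<forall>i\<in>I. rel_bounded E (A i))"

definition locally_finite_family ::
  "('x \<times> 'x) set set \<Rightarrow> 'i set \<Rightarrow> ('i \<Rightarrow> 'x set) \<Rightarrow> bool" where
  "locally_finite_family \<E> I A \<longleftrightarrow>
     (\<forall>B. coarsely_bounded \<E> B \<longrightarrow> finite {i \<in> I. A i \<inter> B \<noteq> {}})"

text \<open>Existence of a partition is stated for a set of subsets of \<open>X\<close>, indexed by itself; this
  avoids quantifying over index types.\<close>

definition coarsely_locally_finite :: "'x set \<Rightarrow> ('x \<times> 'x) set set \<Rightarrow> bool" where
  "coarsely_locally_finite X \<E> \<longleftrightarrow>
     (\<exists>P :: 'x set set. controlled_partition X \<E> P (\<lambda>C. C) \<and> locally_finite_family \<E> P (\<lambda>C. C))"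

definition coarsely_equivalent ::
  "'x set \<Rightarrow> ('x \<times> 'x) set set \<Rightarrow> 'y set \<Rightarrow> ('y \<times> 'y) set set \<Rightarrow> bool" where
  "coarsely_equivalent X \<E> Y \<F> \<longleftrightarrow>
     (\<exists>f \<in> X \<rightarrow> Y. \<exists>g \<in> Y \<rightarrow> X.
        (\<forall>E\<in>\<E>. map_prod f f ` E \<in> \<F>) \<and> (\<forall>F\<in>\<F>. map_prod g g ` F \<in> \<E>) \<and>
        {(g (f x), x) |x. x \<in> X} \<in> \<E> \<and> {(f (g y), y) |y. y \<in> Y} \<in> \<F>)"

text \<open>Up to bijection, a countable set is a subset of the natural numbers.\<close>

definition coarsely_countable :: "'x set \<Rightarrow> ('x \<times> 'x) set set \<Rightarrow> bool" where
  "coarsely_countable X \<E> \<longleftrightarrow>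
     (\<exists>(Y :: nat set) \<F>. coarse_space Y \<F> \<and> coarsely_equivalent X \<E> Y \<F>)"


section \<open>Complex Hilbert spaces and their bounded operators\<close>

text \<open>A complex Hilbert space, together with the real Hilbert space structure it carries. The inner
  product is linear in its second argument. Its definiteness and the unit law of \<open>scaleC\<close> are
  inherited from \<^class>\<open>real_inner\<close>.\<close>

class complex_hilbert_space = real_inner + banach +
  fixes scaleC :: "complex \<Rightarrow> 'a \<Rightarrow> 'a"  (infixr \<open>*\<^sub>C\<close> 75)
    and cinner :: "'a \<Rightarrow> 'a \<Rightarrow> complex"
  assumes scaleC_add_right: "a *\<^sub>C (x + y) = a *\<^sub>C x + a *\<^sub>C y"
    and scaleC_add_left: "(a + b) *\<^sub>C x = a *\<^sub>C x + b *\<^sub>C x"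
    and scaleC_scaleC: "a *\<^sub>C b *\<^sub>C x = (a * b) *\<^sub>C x"
    and scaleR_scaleC: "r *\<^sub>R x = complex_of_real r *\<^sub>C x"
    and cinner_commute: "cinner x y = cnj (cinner y x)"
    and cinner_add_right: "cinner x (y + z) = cinner x y + cinner x z"
    and cinner_scaleC_right: "cinner x (a *\<^sub>C y) = a * cinner x y"
    and inner_eq_Re_cinner: "inner x y = Re (cinner x y)"

instantiation complex :: complex_hilbert_space
begin

definition scaleC_complex :: "complex \<Rightarrow> complex \<Rightarrow> complex" where
  "scaleC_complex a x = a * x"

definition cinner_complex :: "complex \<Rightarrow> complex \<Rightarrow> complex" where
  "cinner_complex x y = cnj x * y"

instance
  by standard
    (simp_all add: scaleC_complex_def cinner_complex_def algebra_simps scaleR_conv_of_real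
      inner_complex_def)

end

global_interpretation cvec: vector_space "scaleC :: complex \<Rightarrow> 'h \<Rightarrow> 'h::complex_hilbert_space"
  defines cspan = cvec.span
proof
  fix x :: 'h
  show "1 *\<^sub>C x = x"
    using scaleR_scaleC[of 1 x] by simp
qed (simp_all add: scaleC_add_right scaleC_add_left scaleC_scaleC)

definition finite_dim_csubspace :: "'h::complex_hilbert_space set \<Rightarrow> bool" where
  "finite_dim_csubspace S \<longleftrightarrow> (\<exists>B. finite B \<and> S = cspan B)"

text \<open>\<^typ>\<open>'a \<Rightarrow>\<^sub>L 'b\<close> is the type of bounded real-linear maps; the bounded operators of a complex
  Hilbert space are its complex-linear elements.\<close>

definition bounded_operators :: "('h::complex_hilbert_space \<Rightarrow>\<^sub>L 'h) set" where
  "bounded_operators = {t. \<forall>c x. blinfun_apply t (c *\<^sub>C x) = c *\<^sub>C blinfun_apply t x}"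

definition self_adjoint :: "('h::complex_hilbert_space \<Rightarrow>\<^sub>L 'h) \<Rightarrow> bool" where
  "self_adjoint t \<longleftrightarrow>
     (\<forall>x y. cinner (blinfun_apply t x) y = cinner x (blinfun_apply t y))"

definition projection_op :: "('h::complex_hilbert_space \<Rightarrow>\<^sub>L 'h) \<Rightarrow> bool" where
  "projection_op p \<longleftrightarrow> p \<in> bounded_operators \<and> self_adjoint p \<and> p o\<^sub>L p = p"

definition orth_proj :: "'h::complex_hilbert_space set \<Rightarrow> ('h \<Rightarrow>\<^sub>L 'h)" where
  "orth_proj S = (THE p. projection_op p \<and> range (blinfun_apply p) = S)"

definition positive_op :: "('h::complex_hilbert_space \<Rightarrow>\<^sub>L 'h) \<Rightarrow> bool" where
  "positive_op t \<longleftrightarrow> t \<in> bounded_operators \<and> self_adjoint t \<and>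
     (\<forall>x. cinner x (blinfun_apply t x) \<in> \<real>\<^sub>\<ge>\<^sub>0)"

definition compact_op :: "('h::complex_hilbert_space \<Rightarrow>\<^sub>L 'h) \<Rightarrow> bool" where
  "compact_op t \<longleftrightarrow> compact (closure (blinfun_apply t ` cball 0 1))"

definition has_strong_sum ::
  "('i \<Rightarrow> ('h::complex_hilbert_space \<Rightarrow>\<^sub>L 'h)) \<Rightarrow> 'i set \<Rightarrow> ('h \<Rightarrow>\<^sub>L 'h) \<Rightarrow> bool" where
  "has_strong_sum f I s \<longleftrightarrow>
     (\<forall>v. ((\<lambda>i. blinfun_apply (f i) v) has_sum blinfun_apply s v) I)"

definition strong_sum ::
  "('i \<Rightarrow> ('h::complex_hilbert_space \<Rightarrow>\<^sub>L 'h)) \<Rightarrow> 'i set \<Rightarrow> ('h \<Rightarrow>\<^sub>L 'h)" where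
  "strong_sum f I = (THE s. has_strong_sum f I s)"


section \<open>Approximate units\<close>

definition directed_by :: "'l set \<Rightarrow> ('l \<Rightarrow> 'l \<Rightarrow> bool) \<Rightarrow> bool" where
  "directed_by L le \<longleftrightarrow> L \<noteq> {} \<and> (\<forall>l\<in>L. le l l) \<and>
     (\<forall>l\<in>L. \<forall>m\<in>L. \<forall>n\<in>L. le l m \<longrightarrow> le m n \<longrightarrow> le l n) \<and>
     (\<forall>l\<in>L. \<forall>m\<in>L. \<exists>n\<in>L. le l n \<and> le m n)"

definition net_filter :: "'l set \<Rightarrow> ('l \<Rightarrow> 'l \<Rightarrow> bool) \<Rightarrow> 'l filter" where
  "net_filter L le = (INF l\<in>L. principal {m \<in> L. le l m})"

text \<open>The usual notion for a \<open>C\<^sup>*\<close>-algebra \<open>\<A>\<close> of operators: an increasing net of positive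
  contractions in \<open>\<A>\<close>, converging in norm to a two-sided unit. The relation \<open>u l \<le> u m\<close> is the
  order of self-adjoint operators.\<close>

definition approximate_unit ::
  "('h::complex_hilbert_space \<Rightarrow>\<^sub>L 'h) set \<Rightarrow> 'l set \<Rightarrow> ('l \<Rightarrow> 'l \<Rightarrow> bool) \<Rightarrow>
     ('l \<Rightarrow> ('h \<Rightarrow>\<^sub>L 'h)) \<Rightarrow> bool" where
  "approximate_unit \<A> L le u \<longleftrightarrow>
     directed_by L le \<and>
     (\<forall>l\<in>L. u l \<in> \<A> \<and> positive_op (u l) \<and> norm (u l) \<le> 1) \<and>
     (\<forall>l\<in>L. \<forall>m\<in>L. le l m \<longrightarrow> positive_op (u m - u l)) \<and>
     (\<forall>t\<in>\<A>. ((\<lambda>l. u l o\<^sub>L t) \<longlongrightarrow> t) (net_filter L le) \<and>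
             ((\<lambda>l. t o\<^sub>L u l) \<longlongrightarrow> t) (net_filter L le))"


section \<open>Coarse geometric modules\<close>

locale coarse_module = coarse_space X \<E>
  for X :: "'x set" and \<E> :: "('x \<times> 'x) set set" +
  fixes \<AA> :: "'x set set" and ind :: "'x set \<Rightarrow> ('h::complex_hilbert_space \<Rightarrow>\<^sub>L 'h)"
  assumes boolean_algebra: "algebra X \<AA>"
    and ind_projection: "\<And>A. A \<in> \<AA> \<Longrightarrow> projection_op (ind A)"
    and ind_empty: "ind {} = 0"
    and ind_carrier: "ind X = id_blinfun"
    and ind_inter: "\<And>A B. A \<in> \<AA> \<Longrightarrow> B \<in> \<AA> \<Longrightarrow> ind (A \<inter> B) = ind A o\<^sub>L ind B"
    and ind_union: "\<And>A B. A \<in> \<AA> \<Longrightarrow> B \<in> \<AA> \<Longrightarrow>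
          ind (A \<union> B) = ind A + ind B - (ind A o\<^sub>L ind B)"
    and nondegenerate: "\<exists>E. gauge_rel X \<E> E \<and>
          closure (cspan (\<Union>A\<in>{A \<in> \<AA>. rel_bounded E A}. range (blinfun_apply (ind A)))) = UNIV"

definition discrete_partition ::
  "'x set \<Rightarrow> ('x \<times> 'x) set set \<Rightarrow> 'x set set \<Rightarrow>
     ('x set \<Rightarrow> ('h::complex_hilbert_space \<Rightarrow>\<^sub>L 'h)) \<Rightarrow> 'i set \<Rightarrow> ('i \<Rightarrow> 'x set) \<Rightarrow> bool" where
  "discrete_partition X \<E> \<AA> ind I A \<longleftrightarrow>
     indexed_partition X I A \<and>
     (\<forall>i\<in>I. A i \<in> \<AA>) \<and>
     (\<exists>E. gauge_rel X \<E> E \<and> (\<forall>i\<in>I. rel_bounded E (A i))) \<and>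
     has_strong_sum (\<lambda>i. ind (A i)) I id_blinfun \<and>
     (\<forall>C\<subseteq>X. (\<forall>i\<in>I. C \<inter> A i \<in> \<AA>) \<longrightarrow> C \<in> \<AA>)"

definition discrete_module ::
  "'x set \<Rightarrow> ('x \<times> 'x) set set \<Rightarrow> 'x set set \<Rightarrow>
     ('x set \<Rightarrow> ('h::complex_hilbert_space \<Rightarrow>\<^sub>L 'h)) \<Rightarrow> bool" where
  "discrete_module X \<E> \<AA> ind \<longleftrightarrow>
     coarse_module X \<E> \<AA> ind \<and> (\<exists>P :: 'x set set. discrete_partition X \<E> \<AA> ind P (\<lambda>C. C))"

definition controlled_propagation ::
  "('x \<times> 'x) set set \<Rightarrow> 'x set set \<Rightarrow> ('x set \<Rightarrow> ('h::complex_hilbert_space \<Rightarrow>\<^sub>L 'h)) \<Rightarrow>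
     ('h \<Rightarrow>\<^sub>L 'h) \<Rightarrow> bool" where
  "controlled_propagation \<E> \<AA> ind t \<longleftrightarrow>
     (\<exists>E\<in>\<E>. \<forall>B\<in>\<AA>. \<forall>A\<in>\<AA>. separated E B A \<longrightarrow> ind B o\<^sub>L t o\<^sub>L ind A = 0)"

definition locally_compact_op ::
  "('x \<times> 'x) set set \<Rightarrow> 'x set set \<Rightarrow> ('x set \<Rightarrow> ('h::complex_hilbert_space \<Rightarrow>\<^sub>L 'h)) \<Rightarrow>
     ('h \<Rightarrow>\<^sub>L 'h) \<Rightarrow> bool" where
  "locally_compact_op \<E> \<AA> ind t \<longleftrightarrow>
     (\<forall>A\<in>\<AA>. coarsely_bounded \<E> A \<longrightarrow> compact_op (ind A o\<^sub>L t) \<and> compact_op (t o\<^sub>L ind A))"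

definition C_lc ::
  "('x \<times> 'x) set set \<Rightarrow> 'x set set \<Rightarrow> ('x set \<Rightarrow> ('h::complex_hilbert_space \<Rightarrow>\<^sub>L 'h)) \<Rightarrow>
     ('h \<Rightarrow>\<^sub>L 'h) set" where
  "C_lc \<E> \<AA> ind = {t \<in> bounded_operators. locally_compact_op \<E> \<AA> ind t}"

definition C_Roe ::
  "('x \<times> 'x) set set \<Rightarrow> 'x set set \<Rightarrow> ('x set \<Rightarrow> ('h::complex_hilbert_space \<Rightarrow>\<^sub>L 'h)) \<Rightarrow>
     ('h \<Rightarrow>\<^sub>L 'h) set" where
  "C_Roe \<E> \<AA> ind =
     {t \<in> bounded_operators. locally_compact_op \<E> \<AA> ind t \<and> controlled_propagation \<E> \<AA> ind t}"

text \<open>Functions on \<open>I\<close> are extensional, so that distinct functions differ at some \<open>i \<in> I\<close>.\<close>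

definition fd_selections ::
  "('x set \<Rightarrow> ('h::complex_hilbert_space \<Rightarrow>\<^sub>L 'h)) \<Rightarrow> 'i set \<Rightarrow> ('i \<Rightarrow> 'x set) \<Rightarrow>
     ('i \<Rightarrow> 'h set) set" where
  "fd_selections ind I A =
     (\<Pi>\<^sub>E i\<in>I. {S. finite_dim_csubspace S \<and> S \<subseteq> range (blinfun_apply (ind (A i)))})"

definition selection_le :: "'i set \<Rightarrow> ('i \<Rightarrow> 'h set) \<Rightarrow> ('i \<Rightarrow> 'h set) \<Rightarrow> bool" where
  "selection_le I l m \<longleftrightarrow> (\<forall>i\<in>I. l i \<subseteq> m i)"

definition selection_proj ::
  "'i set \<Rightarrow> ('i \<Rightarrow> 'h::complex_hilbert_space set) \<Rightarrow> ('h \<Rightarrow>\<^sub>L 'h)" where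
  "selection_proj I l = strong_sum (\<lambda>i. orth_proj (l i)) I"

end

theory Submission
  imports Defs
begin

text \<open>For a locally compact \<open>t\<close> and each \<open>i\<close>, the operators \<open>ind (A i) t\<close> and \<open>t ind (A i)\<close> are compact,
  so there is a finite-dimensional subspace of the range of \<open>ind (A i)\<close> such that every larger
  projection \<open>q\<close> makes \<open>(ind (A i) - q) t\<close> and \<open>t (ind (A i) - q)\<close> as small as desired. Local finiteness and
  coarse countability leave only countably many nonempty members, so the errors can be chosen summable
  with sum \<open>\<epsilon>\<close>. Summing over \<open>i\<close> bounds \<open>t - p\<^sub>\<lambda> t\<close> and \<open>t - t p\<^sub>\<lambda>\<close> for all large \<open>\<lambda>\<close>.\<close>

section \<open>Projections\<close>

text \<open>The operator \<open>t\<close> is compact only after being cut down to a bounded set, so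
  in general no single finite-dimensional subspace serves all of it. This is why the dimension of
  \<open>l i\<close> may vary freely with \<open>i\<close>: every \<open>i\<close> can be given its
  own tolerance. The two sides are not symmetric. For \<open>ind (A i) t\<close>, the subspace must
  nearly contain the values of the operator, and a finite net of its compact image supplies
  generators. For \<open>t ind (A i)\<close>, it must contain the directions in which the operator
  is large. An adjoint would turn one case into the other; here these directions come instead from
  nearly maximizing finitely many functionals, one for each point of a finite net.\<close>

lemma cinner_scaleC_left: "cinner (a *\<^sub>C x) y = cnj a * cinner x y"
  by (metis cinner_commute cinner_scaleC_right complex_cnj_mult)

lemma cinner_add_left: "cinner (x + y) z = cinner x z + cinner y z"
  by (metis cinner_commute cinner_add_right complex_cnj_add)

lemma cinner_self: "cinner x x = complex_of_real ((norm x)\<^sup>2)"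
proof (rule complex_eqI)
  show "Re (cinner x x) = Re (complex_of_real ((norm x)\<^sup>2))"
    by (simp add: inner_eq_Re_cinner[symmetric] power2_norm_eq_inner)
  have "cinner x x = cnj (cinner x x)"
    by (rule cinner_commute)
  then show "Im (cinner x x) = Im (complex_of_real ((norm x)\<^sup>2))"
    by (metis Im_complex_of_real Reals_cnj_iff complex_is_Real_iff)
qed

lemma norm_scaleC: "norm (a *\<^sub>C x) = cmod a * norm (x :: 'h::complex_hilbert_space)"
proof -
  have "complex_of_real ((norm (a *\<^sub>C x))\<^sup>2) = cnj a * a * complex_of_real ((norm x)\<^sup>2)"
    by (simp only: cinner_self[symmetric] cinner_scaleC_left cinner_scaleC_right mult.assoc)
       (simp add: mult_ac)
  also have "\<dots> = complex_of_real ((cmod a * norm x)\<^sup>2)"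
    by (simp add: power_mult_distrib complex_norm_square mult_ac del: of_real_power)
  finally have "(norm (a *\<^sub>C x))\<^sup>2 = (cmod a * norm x)\<^sup>2"
    using of_real_eq_iff by blast
  then show ?thesis
    by (simp add: power2_eq_iff_nonneg)
qed

lemma norm_cinner_le: "cmod (cinner x y) \<le> norm x * norm y"
proof (cases "cinner x y = 0")
  case False
  \<comment> \<open>Multiplying \<open>y\<close> by this phase makes the complex inner product real
    and nonnegative, which reduces the claim to the real Cauchy-Schwarz inequality.\<close>
  define a where "a = cnj (cinner x y) / cmod (cinner x y)"
  have a: "cmod a = 1"
    using False by (simp add: a_def norm_divide)
  have "a * cinner x y = complex_of_real (cmod (cinner x y))"
    using False
    by (simp add: a_def complex_norm_square[symmetric] mult.commute[of "cnj _"] power2_eq_square)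
  then have "cmod (cinner x y) = inner x (a *\<^sub>C y)"
    by (simp add: inner_eq_Re_cinner cinner_scaleC_right)
  also have "\<dots> \<le> norm x * norm (a *\<^sub>C y)"
    by (rule norm_cauchy_schwarz)
  finally show ?thesis
    by (simp add: norm_scaleC a)
qed simp

lemma bounded_linear_cinner_right: "bounded_linear (cinner x)"
proof (rule bounded_linear_intro[where K = "norm x"])
  fix r y
  show "cinner x (r *\<^sub>R y) = r *\<^sub>R cinner x y"
    by (simp add: scaleR_scaleC[of r y] cinner_scaleC_right scaleR_conv_of_real)
  show "norm (cinner x y) \<le> norm y * norm x"
    using norm_cinner_le[of x y] by (simp add: mult.commute)
qed (rule cinner_add_right)

lemma bounded_linear_cinner_left: "bounded_linear (\<lambda>x. cinner x y)"
  using bounded_linear_compose[OF bounded_linear_cnj bounded_linear_cinner_right[of y]]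
  by (simp add: cinner_commute[symmetric])

lemma bounded_linear_scaleC_right:
  "bounded_linear (\<lambda>x::'h::complex_hilbert_space. a *\<^sub>C x)"
  by (rule bounded_linear_intro[where K = "cmod a"])
     (simp_all add: scaleC_add_right norm_scaleC scaleR_scaleC scaleC_scaleC mult.commute)

lemma blinfun_compose_assoc: "(f o\<^sub>L g) o\<^sub>L h = f o\<^sub>L (g o\<^sub>L h)"
  by (rule blinfun_eqI) simp

section \<open>Orthogonal projections: norms, order and ranges\<close>

lemma self_adjoint_inner:
  "self_adjoint t \<Longrightarrow> inner (blinfun_apply t x) y = inner x (blinfun_apply t y)"
  by (simp add: self_adjoint_def inner_eq_Re_cinner)

lemma
  assumes "projection_op p"
  shows projection_op_scaleC: "blinfun_apply p (c *\<^sub>C x) = c *\<^sub>C blinfun_apply p x"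
    and projection_op_self_adjoint: "self_adjoint p"
    and projection_op_idem: "p o\<^sub>L p = p"
    and projection_op_apply_idem: "blinfun_apply p (blinfun_apply p x) = blinfun_apply p x"
  using assms blinfun_apply_blinfun_compose[of p p x]
  by (simp_all add: projection_op_def bounded_operators_def)

lemma projection_op_bounded: "projection_op p \<Longrightarrow> p \<in> bounded_operators"
  by (simp add: projection_op_def)

lemma projection_op_in_range_iff:
  "projection_op p \<Longrightarrow> x \<in> range (blinfun_apply p) \<longleftrightarrow> blinfun_apply p x = x"
  by (metis projection_op_apply_idem rangeE rangeI)

lemma projection_op_cinner_self:
  "projection_op p \<Longrightarrow> cinner x (blinfun_apply p x) = complex_of_real ((norm (blinfun_apply p x))\<^sup>2)"
  by (metis cinner_self projection_op_apply_idem projection_op_self_adjoint self_adjoint_def)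

lemma projection_op_inner_self:
  "projection_op p \<Longrightarrow> inner x (blinfun_apply p x) = (norm (blinfun_apply p x))\<^sup>2"
  by (simp add: inner_eq_Re_cinner projection_op_cinner_self)

lemma projection_op_norm_apply_le:
  assumes "projection_op p"
  shows "norm (blinfun_apply p x) \<le> norm x"
proof (cases "blinfun_apply p x = 0")
  case False
  have "norm (blinfun_apply p x) * norm (blinfun_apply p x) \<le> norm x * norm (blinfun_apply p x)"
    using norm_cauchy_schwarz[of x "blinfun_apply p x"] projection_op_inner_self[OF assms, of x]
    by (simp add: power2_eq_square)
  with False show ?thesis
    by simp
qed simp

lemma projection_op_norm_le: "projection_op p \<Longrightarrow> norm p \<le> 1"
  by (rule norm_blinfun_bound) (auto simp: projection_op_norm_apply_le)

lemma positive_projection: "projection_op p \<Longrightarrow> positive_op p"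
  by (simp add: positive_op_def projection_op_cinner_self projection_op_bounded
      projection_op_self_adjoint)

lemma projection_op_zero: "projection_op 0"
  by (auto simp: projection_op_def bounded_operators_def self_adjoint_def cinner_self
      linear_0[OF bounded_linear.linear[OF bounded_linear_cinner_left]]
      linear_0[OF bounded_linear.linear[OF bounded_linear_cinner_right]]
      linear_0[OF bounded_linear.linear[OF bounded_linear_scaleC_right]] intro: blinfun_eqI)

text \<open>Taking adjoints reverses a product of self-adjoint operators. Thus one-sided relations,
  such as orthogonality or domination of one projection by another, suffice as hypotheses in what
  follows.\<close>

lemma projection_op_compose_swap:
  assumes "p o\<^sub>L q = r" "projection_op p" "projection_op q" "projection_op r"
  shows "q o\<^sub>L p = r"
proof (rule blinfun_eqI)
  fix x
  have "inner (blinfun_apply (q o\<^sub>L p) x) y = inner (blinfun_apply r x) y" for y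
  proof -
    have "inner (blinfun_apply (q o\<^sub>L p) x) y = inner x (blinfun_apply (p o\<^sub>L q) y)"
      by (simp add: self_adjoint_inner projection_op_self_adjoint assms(2,3))
    also have "\<dots> = inner (blinfun_apply r x) y"
      by (simp only: assms(1) self_adjoint_inner[OF projection_op_self_adjoint[OF assms(4)]])
    finally show ?thesis .
  qed
  then show "blinfun_apply (q o\<^sub>L p) x = blinfun_apply r x"
    using vector_eq_rdot by blast
qed

lemma projection_op_add:
  assumes "projection_op p" "projection_op q" "p o\<^sub>L q = 0"
  shows "projection_op (p + q)"
proof -
  have "q o\<^sub>L p = 0"
    using assms by (intro projection_op_compose_swap[of p q]) (auto simp: projection_op_zero)
  then have "(p + q) o\<^sub>L (p + q) = p + q"
    using assms projection_op_idem[of p] projection_op_idem[of q]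
    by (simp add: bounded_bilinear.add_left[OF bounded_bilinear_blinfun_compose]
        bounded_bilinear.add_right[OF bounded_bilinear_blinfun_compose])
  moreover have "p + q \<in> bounded_operators"
    using assms by (simp add: bounded_operators_def projection_op_scaleC blinfun.add_left scaleC_add_right)
  moreover have "self_adjoint (p + q)"
    using projection_op_self_adjoint[OF assms(1)] projection_op_self_adjoint[OF assms(2)]
    by (simp add: self_adjoint_def blinfun.add_left cinner_add_left cinner_add_right)
  ultimately show ?thesis
    by (simp add: projection_op_def)
qed

lemma projection_op_diff:
  assumes "projection_op p" "projection_op q" "p o\<^sub>L q = q"
  shows "projection_op (p - q)"
proof -
  have "q o\<^sub>L p = q"
    using assms by (intro projection_op_compose_swap[of p q])
  then have "(p - q) o\<^sub>L (p - q) = p - q"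
    using assms projection_op_idem[of p] projection_op_idem[of q]
    by (simp add: bounded_bilinear.diff_left[OF bounded_bilinear_blinfun_compose]
        bounded_bilinear.diff_right[OF bounded_bilinear_blinfun_compose])
  moreover have "p - q \<in> bounded_operators"
    using assms
    by (simp add: bounded_operators_def projection_op_scaleC blinfun.diff_left
        cvec.scale_right_diff_distrib)
  moreover have "self_adjoint (p - q)"
    using projection_op_self_adjoint[OF assms(1)] projection_op_self_adjoint[OF assms(2)]
    by (simp add: self_adjoint_def blinfun.diff_left
        linear_diff[OF bounded_linear.linear[OF bounded_linear_cinner_left]]
        linear_diff[OF bounded_linear.linear[OF bounded_linear_cinner_right]])
  ultimately show ?thesis
    by (simp add: projection_op_def)
qed

lemma projection_op_compose_eq_iff:
  assumes "projection_op p"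
  shows "p o\<^sub>L q = q \<longleftrightarrow> range (blinfun_apply q) \<subseteq> range (blinfun_apply p)"
proof
  show "range (blinfun_apply q) \<subseteq> range (blinfun_apply p)" if "p o\<^sub>L q = q"
    using arg_cong[OF that, of "\<lambda>t. range (blinfun_apply t)"] by auto
  show "p o\<^sub>L q = q" if "range (blinfun_apply q) \<subseteq> range (blinfun_apply p)"
  proof (rule blinfun_eqI)
    show "blinfun_apply (p o\<^sub>L q) x = blinfun_apply q x" for x
      using subsetD[OF that rangeI, of x] unfolding projection_op_in_range_iff[OF assms] by simp
  qed
qed

text \<open>Each projection fixes the range of the other, and adjoints turn
  \<open>p o\<^sub>L q = q\<close> into \<open>q o\<^sub>L p = q\<close>. This is the uniqueness
  behind the definite description in \<open>orth_proj\<close>.\<close>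

lemma projection_op_eqI:
  assumes "projection_op p" "projection_op q" "range (blinfun_apply p) = range (blinfun_apply q)"
  shows "p = q"
proof -
  have "p o\<^sub>L q = q" "q o\<^sub>L p = p"
    using assms by (simp_all add: projection_op_compose_eq_iff)
  moreover from this(1) have "q o\<^sub>L p = q"
    using assms by (intro projection_op_compose_swap[of p q])
  ultimately show ?thesis
    by simp
qed

lemma subspace_range_projection:
  assumes "projection_op p"
  shows "cvec.subspace (range (blinfun_apply p))"
proof (rule cvec.subspaceI)
  show "0 \<in> range (blinfun_apply p)"
    by (simp add: projection_op_in_range_iff[OF assms])
qed (simp_all add: projection_op_in_range_iff[OF assms] blinfun.add_right projection_op_scaleC[OF assms])


section \<open>Compact operators\<close>

lemma norm_blinfun_le_on_unit_sphere:
  assumes "c \<ge> 0" "\<And>x. norm x = 1 \<Longrightarrow> norm (blinfun_apply f x) \<le> c"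
  shows "norm f \<le> c"
proof (rule norm_blinfun_bound)
  fix x
  show "norm (blinfun_apply f x) \<le> c * norm x"
  proof (cases "x = 0")
    case False
    then have "norm (blinfun_apply f (x /\<^sub>R norm x)) \<le> c"
      by (intro assms(2)) simp
    with False show ?thesis
      by (simp add: blinfun.scaleR_right field_simps)
  qed simp
qed fact

lemma compact_opI:
  assumes "compact K" "blinfun_apply t ` cball 0 1 \<subseteq> K"
  shows "compact_op t"
  unfolding compact_op_def
  using assms by (metis closed_closure closure_minimal compact_Int_closed compact_imp_closed inf.absorb_iff2)

lemma compact_op_add:
  assumes "compact_op s" "compact_op t"
  shows "compact_op (s + t)"
proof (rule compact_opI)
  show "compact {x + y |x y. x \<in> closure (blinfun_apply s ` cball 0 1) \<and>
      y \<in> closure (blinfun_apply t ` cball 0 1)}"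
    using assms compact_sums unfolding compact_op_def by blast
  show "blinfun_apply (s + t) ` cball 0 1 \<subseteq>
    {x + y |x y. x \<in> closure (blinfun_apply s ` cball 0 1) \<and>
      y \<in> closure (blinfun_apply t ` cball 0 1)}"
  proof (rule image_subsetI)
    fix x :: 'a
    assume "x \<in> cball 0 1"
    then have "blinfun_apply s x \<in> closure (blinfun_apply s ` cball 0 1)"
      "blinfun_apply t x \<in> closure (blinfun_apply t ` cball 0 1)"
      by (intro subsetD[OF closure_subset] imageI; assumption)+
    then show "blinfun_apply (s + t) x \<in> {x + y |x y. x \<in> closure (blinfun_apply s ` cball 0 1) \<and>
        y \<in> closure (blinfun_apply t ` cball 0 1)}"
      unfolding blinfun.add_left by blast
  qed
qed

lemma compact_op_zero: "compact_op 0"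
  by (rule compact_opI[of "{0}"]) auto

lemma compact_op_sum:
  "(\<And>i. i \<in> F \<Longrightarrow> compact_op (f i)) \<Longrightarrow> compact_op (\<Sum>i\<in>F. f i)"
  by (induction F rule: infinite_finite_induct) (auto simp: compact_op_zero compact_op_add)

lemma compact_op_compose_left:
  assumes "compact_op t"
  shows "compact_op (s o\<^sub>L t)"
proof (rule compact_opI)
  show "compact (blinfun_apply s ` closure (blinfun_apply t ` cball 0 1))"
    using assms unfolding compact_op_def
    by (rule compact_continuous_image[OF linear_continuous_on[OF blinfun.bounded_linear_right]])
  show "blinfun_apply (s o\<^sub>L t) ` cball 0 1 \<subseteq> blinfun_apply s ` closure (blinfun_apply t ` cball 0 1)"
  proof (rule image_subsetI)
    fix x :: 'a
    assume "x \<in> cball 0 1"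
    then show "blinfun_apply (s o\<^sub>L t) x \<in> blinfun_apply s ` closure (blinfun_apply t ` cball 0 1)"
      unfolding blinfun_apply_blinfun_compose by (intro imageI subsetD[OF closure_subset])
  qed
qed

lemma compact_op_compose_right:
  assumes "compact_op t"
  shows "compact_op (t o\<^sub>L s)"
proof (rule compact_opI)
  \<comment> \<open>The summand 1 keeps \<open>r\<close> positive when \<open>s\<close> is zero, so
    that \<open>blinfun_apply s x\<close> can be rescaled into the unit ball.\<close>
  define r where "r = norm s + 1"
  have r: "r > 0"
    by (simp add: r_def add_nonneg_pos)
  show "compact ((*\<^sub>R) r ` closure (blinfun_apply t ` cball 0 1))"
    using assms unfolding compact_op_def by (rule compact_scaling)
  show "blinfun_apply (t o\<^sub>L s) ` cball 0 1 \<subseteq> (*\<^sub>R) r ` closure (blinfun_apply t ` cball 0 1)"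
  proof (rule image_subsetI)
    fix x :: 'a
    assume "x \<in> cball 0 1"
    then have "norm (blinfun_apply s x) \<le> norm s * 1"
      by (intro order_trans[OF norm_blinfun] mult_left_mono) auto
    then have "blinfun_apply s x /\<^sub>R r \<in> cball 0 1"
      using r by (simp add: r_def field_simps)
    then have "blinfun_apply t (blinfun_apply s x /\<^sub>R r) \<in> closure (blinfun_apply t ` cball 0 1)"
      by (intro subsetD[OF closure_subset] imageI)
    moreover have "blinfun_apply (t o\<^sub>L s) x = r *\<^sub>R blinfun_apply t (blinfun_apply s x /\<^sub>R r)"
      using r by (simp add: blinfun.scaleR_right)
    ultimately show "blinfun_apply (t o\<^sub>L s) x \<in> (*\<^sub>R) r ` closure (blinfun_apply t ` cball 0 1)"
      by blast
  qed
qed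

text \<open>Total boundedness of the image of the unit ball is the form in which both approximation
  results use compactness.\<close>

lemma compact_op_finite_net:
  assumes "compact_op t" "\<epsilon> > 0"
  obtains F where "finite F"
    "\<And>x. norm x \<le> 1 \<Longrightarrow> \<exists>z\<in>F. norm (blinfun_apply t x - blinfun_apply t z) < \<epsilon>"
proof -
  let ?K = "blinfun_apply t ` cball 0 1"
  have "closure ?K \<subseteq> (\<Union>z\<in>cball 0 1. ball (blinfun_apply t z) \<epsilon>)"
  proof
    fix y assume "y \<in> closure ?K"
    then obtain z where "z \<in> cball 0 1" "dist (blinfun_apply t z) y < \<epsilon>"
      using assms(2) unfolding closure_approachable by blast
    then show "y \<in> (\<Union>z\<in>cball 0 1. ball (blinfun_apply t z) \<epsilon>)"
      by auto
  qed
  with assms(1) obtain F where F: "F \<subseteq> cball 0 1" "finite F" "closure ?K \<subseteq> (\<Union>z\<in>F. ball (blinfun_apply t z) \<epsilon>)"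
    unfolding compact_op_def
    using compactE_image[of "closure ?K" "cball 0 1" "\<lambda>z. ball (blinfun_apply t z) \<epsilon>"] by auto
  show ?thesis
  proof
    show "finite F" by fact
    show "\<exists>z\<in>F. norm (blinfun_apply t x - blinfun_apply t z) < \<epsilon>" if "norm x \<le> 1" for x
    proof -
      have "blinfun_apply t x \<in> closure ?K"
        using that by (intro subsetD[OF closure_subset] imageI) simp
      with F(3) obtain z where "z \<in> F" "blinfun_apply t x \<in> ball (blinfun_apply t z) \<epsilon>"
        by blast
      then show ?thesis
        by (auto simp: dist_norm norm_minus_commute)
    qed
  qed
qed


section \<open>Projections onto finite-dimensional subspaces\<close>

lemma rank_one_projection:
  fixes e :: "'h::complex_hilbert_space"
  assumes "norm e = 1"
  obtains r where "projection_op r" "compact_op r" "\<And>x. blinfun_apply r x = cinner e x *\<^sub>C e"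
proof -
  have "bounded_linear (\<lambda>a. a *\<^sub>C e)"
    by (rule bounded_linear_intro[where K = "norm e"])
       (simp_all add: scaleC_add_left norm_scaleC scaleR_scaleC[of _ e] scaleC_scaleC scaleR_conv_of_real,
        simp_all add: scaleR_scaleC scaleC_scaleC)
  note scale = this
  define r where "r = Blinfun (\<lambda>x. cinner e x *\<^sub>C e)"
  have r: "blinfun_apply r x = cinner e x *\<^sub>C e" for x
    unfolding r_def
    by (simp add: bounded_linear_Blinfun_apply
        bounded_linear_compose[OF scale bounded_linear_cinner_right])
  show ?thesis
  proof
    show "projection_op r"
      unfolding projection_op_def bounded_operators_def self_adjoint_def
    proof (intro conjI CollectI allI blinfun_eqI)
      fix x y
      show "cinner (blinfun_apply r x) y = cinner x (blinfun_apply r y)"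
        by (simp add: r cinner_scaleC_left cinner_scaleC_right cinner_commute[of x e])
    qed (simp_all add: r scaleC_scaleC cinner_scaleC_right cinner_self assms)
    show "compact_op r"
    proof (rule compact_opI)
      show "compact ((\<lambda>a. a *\<^sub>C e) ` cball 0 1)"
        by (intro compact_continuous_image linear_continuous_on scale compact_cball)
      show "blinfun_apply r ` cball 0 1 \<subseteq> (\<lambda>a. a *\<^sub>C e) ` cball 0 1"
        using order_trans[OF norm_cinner_le[of e]] by (auto simp: r assms)
    qed
  qed (rule r)
qed

text \<open>Gram-Schmidt, one generator at a time: the part of \<open>b\<close> orthogonal to the
  span so far is normalized to \<open>e\<close>, and the rank-one projection onto \<open>e\<close>
  is added. Compactness is inherited from the rank-one summands.\<close>

lemma finite_span_projection:
  fixes B :: "'h::complex_hilbert_space set"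
  assumes "finite B"
  shows "\<exists>p. projection_op p \<and> compact_op p \<and> range (blinfun_apply p) = cspan B"
  using assms
proof induction
  case empty
  show ?case
    by (rule exI[of _ 0]) (auto simp: projection_op_zero compact_op_zero)
next
  case (insert b B)
  then obtain p where p: "projection_op p" "compact_op p" "range (blinfun_apply p) = cspan B"
    by blast
  define b' where "b' = b - blinfun_apply p b"
  have pb': "blinfun_apply p b' = 0"
    by (simp add: b'_def blinfun.diff_right projection_op_apply_idem[OF p(1)])
  have pb: "blinfun_apply p b \<in> cspan B"
    using p(3) by blast
  show ?case
  proof (cases "b' = 0")
    case True
    then have "b \<in> cspan B"
      using pb by (simp add: b'_def)
    then have "cspan (insert b B) = cspan B"
      by (rule cvec.span_redundant)
    with p show ?thesis
      by auto
  next
    case False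
    define e where "e = b' /\<^sub>R norm b'"
    have e: "norm e = 1"
      using False by (simp add: e_def)
    have b'e: "b' = complex_of_real (norm b') *\<^sub>C e"
      using False by (simp add: e_def flip: scaleR_scaleC)
    have pe: "blinfun_apply p e = 0"
      by (simp add: e_def blinfun.scaleR_right pb')
    obtain r where r: "projection_op r" "compact_op r"
      "\<And>x. blinfun_apply r x = cinner e x *\<^sub>C e"
      using rank_one_projection[OF e] by metis
    have pr: "p o\<^sub>L r = 0"
      by (rule blinfun_eqI) (simp add: r(3) projection_op_scaleC[OF p(1)] pe)
    then have "r o\<^sub>L p = 0"
      using p(1) r(1) projection_op_zero by (rule projection_op_compose_swap)
    then have rp: "blinfun_apply r (blinfun_apply p x) = 0" for x
      by (metis blinfun_apply_blinfun_compose blinfun.zero_left)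
    have sum: "projection_op (p + r)"
      using projection_op_add p(1) r(1) pr by blast
    have re: "blinfun_apply r e = e"
      by (simp add: r(3) cinner_self e)
    have "blinfun_apply r b' = b'"
      by (metis b'e re projection_op_scaleC[OF r(1)])
    then have "blinfun_apply r b = b'"
      using rp[of b] by (simp add: b'_def blinfun.diff_right)
    then have "b \<in> range (blinfun_apply (p + r))"
      unfolding projection_op_in_range_iff[OF sum] by (simp add: blinfun.add_left b'_def)
    moreover have "x \<in> range (blinfun_apply (p + r))" if "x \<in> B" for x
    proof -
      have "blinfun_apply p x = x"
        using cvec.span_base[OF that] unfolding p(3)[symmetric]
        by (rule iffD1[OF projection_op_in_range_iff[OF p(1)]])
      moreover from this have "blinfun_apply r x = 0"
        using rp[of x] by (rule subst)
      ultimately have "blinfun_apply (p + r) x = x"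
        unfolding blinfun.add_left by (simp only: add_0_right)
      then show ?thesis
        by (rule iffD2[OF projection_op_in_range_iff[OF sum]])
    qed
    ultimately have "cspan (insert b B) \<subseteq> range (blinfun_apply (p + r))"
      by (intro cvec.span_minimal[OF _ subspace_range_projection[OF sum]] subsetI)
        (metis insertE)
    moreover have "blinfun_apply (p + r) x \<in> cspan (insert b B)" for x
    proof -
      have sub: "blinfun_apply p y \<in> cspan (insert b B)" for y
        using p(3) cvec.span_mono[of B "insert b B"] by blast
      then have "b' \<in> cspan (insert b B)"
        unfolding b'_def by (intro cvec.span_diff) (auto intro: cvec.span_base)
      then have "e \<in> cspan (insert b B)"
        by (simp add: e_def scaleR_scaleC cvec.span_scale)
      then show ?thesis
        by (simp add: blinfun.add_left r(3) sub cvec.span_add cvec.span_scale)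
    qed
    ultimately have "range (blinfun_apply (p + r)) = cspan (insert b B)"
      by (intro subset_antisym image_subsetI)
    then show ?thesis
      using sum compact_op_add[OF p(2) r(2)] by (intro exI[of _ "p + r"]) simp
  qed
qed

lemma
  assumes "finite_dim_csubspace S"
  shows projection_orth_proj: "projection_op (orth_proj S)"
    and compact_orth_proj: "compact_op (orth_proj S)"
    and range_orth_proj: "range (blinfun_apply (orth_proj S)) = S"
proof -
  obtain B where "finite B" "S = cspan B"
    using assms unfolding finite_dim_csubspace_def by blast
  with finite_span_projection[of B]
  obtain p where p: "projection_op p" "compact_op p" "range (blinfun_apply p) = S"
    by auto
  have "orth_proj S = p"
    unfolding orth_proj_def
  proof (rule the_equality)
    show "p' = p" if "projection_op p' \<and> range (blinfun_apply p') = S" for p'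
      using that p projection_op_eqI[of p' p] by simp
  qed (simp add: p)
  with p show "projection_op (orth_proj S)" "compact_op (orth_proj S)"
    "range (blinfun_apply (orth_proj S)) = S"
    by simp_all
qed


section \<open>Strong sums\<close>

lemma has_strong_sum_unique: "has_strong_sum f I s \<Longrightarrow> has_strong_sum f I t \<Longrightarrow> s = t"
  unfolding has_strong_sum_def by (metis blinfun_eqI has_sum_unique)

lemma has_strong_sum_compose_left:
  assumes "has_strong_sum f I s"
  shows "has_strong_sum (\<lambda>i. t o\<^sub>L f i) I (t o\<^sub>L s)"
  using assms has_sum_bounded_linear[OF blinfun.bounded_linear_right]
  unfolding has_strong_sum_def by (fastforce simp: o_def)

lemma has_strong_sum_compose_right:
  "has_strong_sum f I s \<Longrightarrow> has_strong_sum (\<lambda>i. f i o\<^sub>L t) I (s o\<^sub>L t)"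
  unfolding has_strong_sum_def by simp

lemma has_strong_sum_diff:
  assumes "has_strong_sum f I s" "has_strong_sum g I t"
  shows "has_strong_sum (\<lambda>i. f i - g i) I (s - t)"
  unfolding has_strong_sum_def
proof
  fix v
  have "((\<lambda>i. blinfun_apply (f i) v + - blinfun_apply (g i) v) has_sum
      blinfun_apply s v + - blinfun_apply t v) I"
    using assms unfolding has_strong_sum_def by (intro has_sum_add has_sum_uminus[THEN iffD2]) auto
  then show "((\<lambda>i. blinfun_apply (f i - g i) v) has_sum blinfun_apply (s - t) v) I"
    by (simp add: blinfun.diff_left)
qed

lemma has_strong_sum_cong:
  "(\<And>i. i \<in> I \<Longrightarrow> f i = g i) \<Longrightarrow> has_strong_sum f I s \<longleftrightarrow> has_strong_sum g I s"
  unfolding has_strong_sum_def by (simp cong: has_sum_cong)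

lemma has_strong_sum_finite_support:
  assumes "finite F" "F \<subseteq> I" "\<And>i. i \<in> I - F \<Longrightarrow> f i = 0"
  shows "has_strong_sum f I (\<Sum>i\<in>F. f i)"
  unfolding has_strong_sum_def
proof
  fix v
  have "((\<lambda>i. blinfun_apply (f i) v) has_sum (\<Sum>i\<in>F. blinfun_apply (f i) v)) F"
    using assms(1) by (rule has_sum_finite)
  then show "((\<lambda>i. blinfun_apply (f i) v) has_sum blinfun_apply (\<Sum>i\<in>F. f i) v) I"
    using assms(2,3) by (subst has_sum_cong_neutral[where T = F]) (auto simp: blinfun.sum_left)
qed

text \<open>The sum need not converge in norm. The triangle inequality bounds every finite partial
  sum at a fixed vector, and this bound survives the pointwise limit.\<close>

lemma has_strong_sum_norm_le:
  assumes "has_strong_sum f I s" "\<And>i. i \<in> I \<Longrightarrow> norm (f i) \<le> e i" "c \<ge> 0"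
    "\<And>F. finite F \<Longrightarrow> F \<subseteq> I \<Longrightarrow> sum e F \<le> c"
  shows "norm s \<le> c"
proof (rule norm_blinfun_bound)
  fix v
  have "((\<lambda>F. \<Sum>i\<in>F. blinfun_apply (f i) v) \<longlongrightarrow> blinfun_apply s v) (finite_subsets_at_top I)"
    using assms(1) by (simp add: has_strong_sum_def has_sum_def)
  then show "norm (blinfun_apply s v) \<le> c * norm v"
  proof (rule tendsto_upperbound[OF tendsto_norm])
    show "\<forall>\<^sub>F F in finite_subsets_at_top I. norm (\<Sum>i\<in>F. blinfun_apply (f i) v) \<le> c * norm v"
    proof (rule eventually_finite_subsets_at_top_weakI)
      fix F assume F: "finite F" "F \<subseteq> I"
      have "norm (\<Sum>i\<in>F. blinfun_apply (f i) v) \<le> (\<Sum>i\<in>F. e i * norm v)"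
        using F assms(2)
        by (intro sum_norm_le order_trans[OF norm_blinfun] mult_right_mono) auto
      also have "\<dots> \<le> c * norm v"
        using assms(4)[OF F] by (simp add: mult_right_mono flip: sum_distrib_right)
      finally show "norm (\<Sum>i\<in>F. blinfun_apply (f i) v) \<le> c * norm v" .
    qed
  qed simp
qed (fact assms(3))

section \<open>Strong sums of pairwise orthogonal projections\<close>

context
  fixes q :: "'i \<Rightarrow> 'h::complex_hilbert_space \<Rightarrow>\<^sub>L 'h" and I :: "'i set"
  assumes proj: "\<And>i. i \<in> I \<Longrightarrow> projection_op (q i)"
    and orth: "\<And>i j. i \<in> I \<Longrightarrow> j \<in> I \<Longrightarrow> i \<noteq> j \<Longrightarrow> q i o\<^sub>L q j = 0"
begin

lemma projection_op_sum_orthogonal: "finite F \<Longrightarrow> F \<subseteq> I \<Longrightarrow> projection_op (\<Sum>i\<in>F. q i)"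
proof (induction rule: finite_induct)
  case (insert j F)
  have "q j o\<^sub>L (\<Sum>i\<in>F. q i) = (\<Sum>i\<in>F. q j o\<^sub>L q i)"
    by (rule bounded_bilinear.sum_right[OF bounded_bilinear_blinfun_compose])
  also have "\<dots> = 0"
    using insert by (intro sum.neutral) (auto intro: orth)
  finally show ?case
    using insert proj by (simp add: projection_op_add)
qed (simp add: projection_op_zero)

text \<open>A finite sum is itself a projection, so its squared norm at \<open>v\<close> equals an
  inner product with \<open>v\<close>. That expression is additive over the summands, which gives
  Pythagoras.\<close>

lemma norm_sum_orthogonal:
  assumes "finite F" "F \<subseteq> I"
  shows "(norm (\<Sum>i\<in>F. blinfun_apply (q i) v))\<^sup>2 = (\<Sum>i\<in>F. (norm (blinfun_apply (q i) v))\<^sup>2)"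
proof -
  have "(norm (\<Sum>i\<in>F. blinfun_apply (q i) v))\<^sup>2 = inner v (\<Sum>i\<in>F. blinfun_apply (q i) v)"
    using projection_op_inner_self[OF projection_op_sum_orthogonal[OF assms], of v]
    by (simp add: blinfun.sum_left)
  also have "\<dots> = (\<Sum>i\<in>F. (norm (blinfun_apply (q i) v))\<^sup>2)"
    using assms(2) by (auto simp: inner_sum_right intro!: sum.cong projection_op_inner_self proj)
  finally show ?thesis .
qed

text \<open>Bessel's inequality makes the squared norms summable. The norms themselves may fail to
  be summable, so absolute convergence is out of reach; instead the partial sums form a Cauchy net,
  because by Pythagoras their distances are differences of sums of squares.\<close>

lemma summable_orthogonal: "(\<lambda>i. blinfun_apply (q i) v) summable_on I"
proof -
  have "(\<Sum>i\<in>F. (norm (blinfun_apply (q i) v))\<^sup>2) \<le> (norm v)\<^sup>2" if "finite F" "F \<subseteq> I" for F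
    using norm_sum_orthogonal[OF that, of v]
      projection_op_norm_apply_le[OF projection_op_sum_orthogonal[OF that], of v]
    by (simp add: blinfun.sum_left flip: norm_sum_orthogonal[OF that])
  then have sq: "(\<lambda>i. (norm (blinfun_apply (q i) v))\<^sup>2) summable_on I"
    by (intro nonneg_bdd_above_summable_on bdd_aboveI[of _ "(norm v)\<^sup>2"]) auto
  then obtain L where L: "((\<lambda>F. \<Sum>i\<in>F. (norm (blinfun_apply (q i) v))\<^sup>2) \<longlongrightarrow> L) (finite_subsets_at_top I)"
    unfolding summable_on_def has_sum_def by blast
  let ?s = "\<lambda>F. \<Sum>i\<in>F. blinfun_apply (q i) v"
  have "\<exists>P. eventually P (finite_subsets_at_top I) \<and> (\<forall>F G. P F \<and> P G \<longrightarrow> dist (?s F) (?s G) < e)"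
    if "e > 0" for e
  proof -
    \<comment> \<open>Two sums of squares within \<open>e\<^sup>2 / 8\<close> of \<open>L\<close>
      differ by less than \<open>(e / 2)\<^sup>2\<close>. The remaining factor 2 pays for comparing
      two arbitrary partial sums through \<open>F0\<close>.\<close>
    have "e\<^sup>2 / 8 > 0"
      using that by simp
    from tendstoD[OF L this] obtain F0 where F0: "finite F0" "F0 \<subseteq> I"
      "\<forall>F. finite F \<and> F0 \<subseteq> F \<and> F \<subseteq> I \<longrightarrow>
        \<bar>(\<Sum>i\<in>F. (norm (blinfun_apply (q i) v))\<^sup>2) - L\<bar> < e\<^sup>2 / 8"
      unfolding eventually_finite_subsets_at_top dist_real_def
      by (elim exE conjE) (rule that)
    define P where "P F \<longleftrightarrow> finite F \<and> F0 \<subseteq> F \<and> F \<subseteq> I" for F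
    have near: "dist (?s F) (?s F0) < e / 2" if "P F" for F
    proof -
      have F: "finite F" "F0 \<subseteq> F" "F \<subseteq> I"
        using that by (auto simp: P_def)
      have "(dist (?s F) (?s F0))\<^sup>2 = (norm (?s (F - F0)))\<^sup>2"
        using F by (simp add: dist_norm sum_diff)
      also have "\<dots> = (\<Sum>i\<in>F. (norm (blinfun_apply (q i) v))\<^sup>2) - (\<Sum>i\<in>F0. (norm (blinfun_apply (q i) v))\<^sup>2)"
        using F by (subst norm_sum_orthogonal) (auto simp: sum_diff)
      also have "\<dots> < (e / 2)\<^sup>2"
      proof -
        have "\<bar>(\<Sum>i\<in>F. (norm (blinfun_apply (q i) v))\<^sup>2) - L\<bar> < e\<^sup>2 / 8"
          "\<bar>(\<Sum>i\<in>F0. (norm (blinfun_apply (q i) v))\<^sup>2) - L\<bar> < e\<^sup>2 / 8"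
          using F0 F by (auto intro!: F0(3)[rule_format])
        moreover have "(e / 2)\<^sup>2 = e\<^sup>2 / 4"
          by (simp add: power_divide)
        ultimately show ?thesis
          by linarith
      qed
      finally show ?thesis
        using \<open>e > 0\<close> by (rule power2_less_imp_less[OF _ less_imp_le[OF half_gt_zero]])
    qed
    have "eventually P (finite_subsets_at_top I)"
      unfolding eventually_finite_subsets_at_top P_def using F0(1,2) by auto
    moreover have "dist (?s F) (?s G) < e" if "P F" "P G" for F G
      using near[OF that(1)] near[OF that(2)] by (rule dist_triangle_half_l)
    ultimately show ?thesis
      by blast
  qed
  then have "cauchy_filter (filtermap ?s (finite_subsets_at_top I))"
    by (simp add: cauchy_filter_metric_filtermap)
  moreover have "complete (UNIV :: 'h set)"
    by (meson Cauchy_convergent UNIV_I complete_def convergent_def)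
  ultimately obtain L' where "(?s \<longlongrightarrow> L') (finite_subsets_at_top I)"
    using complete_uniform[where S = UNIV] by (force simp: filterlim_def)
  then show ?thesis
    unfolding summable_on_def has_sum_def by blast
qed

lemma orthogonal_strong_sum: "\<exists>s. has_strong_sum q I s \<and> projection_op s"
proof -
  define S where "S v = infsum (\<lambda>i. blinfun_apply (q i) v) I" for v
  have S: "((\<lambda>i. blinfun_apply (q i) v) has_sum S v) I" for v
    unfolding S_def using summable_orthogonal by (rule has_sum_infsum)
  have bl: "bounded_linear S"
  proof (rule bounded_linear_intro[where K = 1])
    show "S (x + y) = S x + S y" for x y
      using has_sum_unique[OF S[of "x + y"]] has_sum_add[OF S[of x] S[of y]]
      by (simp add: blinfun.add_right)
    show "S (r *\<^sub>R x) = r *\<^sub>R S x" for r x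
      using has_sum_unique[OF S[of "r *\<^sub>R x"]] has_sum_scaleR[OF S[of x], of r]
      by (simp add: blinfun.scaleR_right)
    show "norm (S v) \<le> norm v * 1" for v
    proof -
      have "((\<lambda>F. \<Sum>i\<in>F. blinfun_apply (q i) v) \<longlongrightarrow> S v) (finite_subsets_at_top I)"
        using S by (simp add: has_sum_def)
      then have "norm (S v) \<le> norm v"
      proof (rule tendsto_upperbound[OF tendsto_norm])
        show "\<forall>\<^sub>F F in finite_subsets_at_top I. norm (\<Sum>i\<in>F. blinfun_apply (q i) v) \<le> norm v"
          using projection_op_norm_apply_le[OF projection_op_sum_orthogonal, of _ v]
          by (intro eventually_finite_subsets_at_top_weakI) (simp add: blinfun.sum_left)
      qed simp
      then show ?thesis by simp
    qed
  qed
  define s where "s = Blinfun S"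
  have s: "blinfun_apply s = S"
    unfolding s_def using bl by (rule bounded_linear_Blinfun_apply)
  have sum: "has_strong_sum q I s"
    by (simp add: has_strong_sum_def s S)
  have "s \<in> bounded_operators"
    unfolding bounded_operators_def
  proof (intro CollectI allI)
    fix c x
    have "((\<lambda>i. blinfun_apply (q i) (c *\<^sub>C x)) has_sum c *\<^sub>C S x) I"
      using has_sum_bounded_linear[OF bounded_linear_scaleC_right[of c] S[of x]]
      by (subst has_sum_cong[OF projection_op_scaleC[OF proj]]) (simp_all add: o_def)
    then show "blinfun_apply s (c *\<^sub>C x) = c *\<^sub>C blinfun_apply s x"
      unfolding s by (rule has_sum_unique[OF S])
  qed
  moreover have "self_adjoint s"
    unfolding self_adjoint_def
  proof (intro allI)
    fix x y
    have "((\<lambda>i. cinner x (blinfun_apply (q i) y)) has_sum cinner x (S y)) I"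
      using has_sum_bounded_linear[OF bounded_linear_cinner_right S[of y], of x] by (simp add: o_def)
    moreover have "((\<lambda>i. cinner x (blinfun_apply (q i) y)) has_sum cinner (S x) y) I"
      using has_sum_bounded_linear[OF bounded_linear_cinner_left S[of x], of y]
      by (subst has_sum_cong[where g = "\<lambda>i. cinner (blinfun_apply (q i) x) y"])
         (simp_all add: o_def projection_op_self_adjoint[OF proj, unfolded self_adjoint_def])
    ultimately show "cinner (blinfun_apply s x) y = cinner x (blinfun_apply s y)"
      unfolding s by (rule has_sum_unique[rotated])
  qed
  moreover have "s o\<^sub>L s = s"
  proof -
    \<comment> \<open>Orthogonality leaves only the term \<open>j = i\<close>. Hence
      \<open>s o\<^sub>L s\<close>, the strong sum of the operators \<open>q i o\<^sub>L s\<close>,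
      is the strong sum of the \<open>q i\<close>, and no double sum arises.\<close>
    have "q i o\<^sub>L s = q i" if "i \<in> I" for i
    proof -
      have "has_strong_sum (\<lambda>j. q i o\<^sub>L q j) I (\<Sum>j\<in>{i}. q i o\<^sub>L q j)"
        using that orth by (intro has_strong_sum_finite_support) auto
      then have "q i o\<^sub>L s = (\<Sum>j\<in>{i}. q i o\<^sub>L q j)"
        by (rule has_strong_sum_unique[OF has_strong_sum_compose_left[OF sum]])
      then show ?thesis
        by (simp add: projection_op_idem[OF proj[OF that]])
    qed
    then have "has_strong_sum (\<lambda>i. q i o\<^sub>L s) I (s o\<^sub>L s) \<longleftrightarrow> has_strong_sum q I (s o\<^sub>L s)"
      by (rule has_strong_sum_cong)
    then have "has_strong_sum q I (s o\<^sub>L s)"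
      using has_strong_sum_compose_right[OF sum, of s] by (rule iffD1)
    then show ?thesis
      using sum by (rule has_strong_sum_unique)
  qed
  ultimately show ?thesis
    using sum by (intro exI[of _ s] conjI) (simp_all only: projection_op_def simp_thms)
qed

end


section \<open>Approximation by finite-dimensional projections\<close>

text \<open>An approximate Riesz representation: almost maximizing \<open>f\<close> on the unit ball gives \<open>u\<close>, and by
  the Pythagorean theorem \<open>f\<close> is then small on the orthogonal complement of \<open>u\<close>. This replaces the
  adjoint of an operator.\<close>

lemma functional_small_on_orthogonal:
  fixes f :: "'a::real_inner \<Rightarrow> real"
  assumes "bounded_linear f" "\<epsilon> > 0"
  obtains u where "\<And>x. norm x \<le> 1 \<Longrightarrow> inner u x = 0 \<Longrightarrow> \<bar>f x\<bar> \<le> \<epsilon>"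
proof -
  interpret bounded_linear f by fact
  obtain K where K: "\<And>x. \<bar>f x\<bar> \<le> norm x * K" "K > 0"
    using pos_bounded by auto
  define s where "s = (SUP x\<in>cball 0 1. (f x)\<^sup>2)"
  have bdd: "bdd_above ((\<lambda>x. (f x)\<^sup>2) ` cball 0 1)"
  proof (rule bdd_aboveI2)
    fix x :: 'a assume "x \<in> cball 0 1"
    then have "\<bar>f x\<bar> \<le> K"
      using K(2) by (intro order_trans[OF K(1)] mult_left_le_one_le) auto
    then show "(f x)\<^sup>2 \<le> K\<^sup>2"
      by (metis abs_ge_zero power2_abs power_mono)
  qed
  have s: "(f x)\<^sup>2 \<le> s * (norm x)\<^sup>2" for x
  proof (cases "x = 0")
    case False
    have "(f (x /\<^sub>R norm x))\<^sup>2 \<le> s"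
      unfolding s_def using False by (intro cSUP_upper[OF _ bdd]) simp
    then have "(f x)\<^sup>2 / (norm x)\<^sup>2 \<le> s"
      by (simp add: scaleR power_mult_distrib power_inverse divide_inverse mult.commute)
    with False show ?thesis
      by (simp add: pos_divide_le_eq)
  qed (simp add: zero)
  \<comment> \<open>The slack \<open>\<epsilon>\<^sup>2\<close> is what remains for
    \<open>(f x)\<^sup>2\<close> once \<open>(f u)\<^sup>2 + (f x)\<^sup>2 \<le> s\<close> is
    known.\<close>
  have "\<exists>u\<in>cball 0 1. s - \<epsilon>\<^sup>2 < (f u)\<^sup>2"
    using less_cSUP_iff[OF _ bdd, of "s - \<epsilon>\<^sup>2"] assms(2) by (simp flip: s_def)
  then obtain u where u: "norm u \<le> 1" "s - \<epsilon>\<^sup>2 < (f u)\<^sup>2"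
    by auto
  show ?thesis
  proof
    fix x assume x: "norm x \<le> 1" "inner u x = 0"
    \<comment> \<open>With these coefficients \<open>f w\<close> equals
      \<open>(f u)\<^sup>2 + (f x)\<^sup>2\<close>, while orthogonality bounds
      \<open>(norm w)\<^sup>2\<close> by the same quantity. Cancelling it once in
      \<open>(f w)\<^sup>2 \<le> s * (norm w)\<^sup>2\<close> gives the bound by
      \<open>s\<close>.\<close>
    define w where "w = f u *\<^sub>R u + f x *\<^sub>R x"
    have s0: "s \<ge> 0"
      using cSUP_upper[OF _ bdd, of 0] by (simp add: s_def zero)
    have "(norm w)\<^sup>2 = (f u)\<^sup>2 * (norm u)\<^sup>2 + (f x)\<^sup>2 * (norm x)\<^sup>2"
      using x(2) norm_add_Pythagorean[of "f u *\<^sub>R u" "f x *\<^sub>R x"]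
      by (simp add: w_def orthogonal_def power_mult_distrib)
    also have "\<dots> \<le> (f u)\<^sup>2 + (f x)\<^sup>2"
      using u(1) x(1) by (intro add_mono mult_left_le) (auto simp: power_le_one)
    finally have "((f u)\<^sup>2 + (f x)\<^sup>2)\<^sup>2 \<le> s * ((f u)\<^sup>2 + (f x)\<^sup>2)"
      using order_trans[OF s[of w] mult_left_mono[OF _ s0]]
      by (simp add: w_def add scaleR power2_eq_square)
    then have "(f u)\<^sup>2 + (f x)\<^sup>2 \<le> s"
      using s0 by (cases "(f u)\<^sup>2 + (f x)\<^sup>2 = 0")
        (auto simp: power2_eq_square[of "_ + _"] sum_power2_gt_zero_iff)
    with u(2) have "(f x)\<^sup>2 \<le> \<epsilon>\<^sup>2"
      by simp
    with assms(2) show "\<bar>f x\<bar> \<le> \<epsilon>"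
      by (metis abs_le_square_iff abs_of_pos)
  qed
qed

text \<open>The generators are the images of a finite net. As \<open>q\<close> fixes them,
  \<open>P - q\<close> kills them, and it is a contraction on the remaining error. Quantifying over
  all such \<open>q\<close> yields an estimate that persists along the net of selections.\<close>

lemma compact_op_left_approximation:
  assumes P: "projection_op P" and c: "compact_op (P o\<^sub>L t)" and "\<epsilon> > 0"
  shows "\<exists>B. finite B \<and> B \<subseteq> range (blinfun_apply P) \<and>
    (\<forall>q. projection_op q \<longrightarrow> P o\<^sub>L q = q \<longrightarrow> B \<subseteq> range (blinfun_apply q) \<longrightarrow> norm ((P - q) o\<^sub>L t) \<le> \<epsilon>)"
proof -
  obtain F where F: "finite F"
    "\<And>x. norm x \<le> 1 \<Longrightarrow> \<exists>z\<in>F. norm (blinfun_apply (P o\<^sub>L t) x - blinfun_apply (P o\<^sub>L t) z) < \<epsilon>"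
    using compact_op_finite_net[OF c \<open>\<epsilon> > 0\<close>] by metis
  show ?thesis
  proof (intro exI conjI allI impI)
    let ?B = "blinfun_apply (P o\<^sub>L t) ` F"
    show "finite ?B" "?B \<subseteq> range (blinfun_apply P)"
      using F(1) by auto
    fix q assume q: "projection_op q" "P o\<^sub>L q = q" "?B \<subseteq> range (blinfun_apply q)"
    have diff: "projection_op (P - q)"
      using projection_op_diff P q by blast
    have qP: "blinfun_apply q (blinfun_apply P y) = blinfun_apply q y" for y
      using projection_op_compose_swap[OF q(2) P q(1) q(1)]
      by (metis blinfun_apply_blinfun_compose)
    have "norm (blinfun_apply ((P - q) o\<^sub>L t) x) \<le> \<epsilon>" if x: "norm x = 1" for x
    proof -
      obtain z where z: "z \<in> F"
        "norm (blinfun_apply P (blinfun_apply t x) - blinfun_apply P (blinfun_apply t z)) < \<epsilon>"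
        using F(2)[of x] x by auto
      have "blinfun_apply q (blinfun_apply P (blinfun_apply t z)) = blinfun_apply P (blinfun_apply t z)"
        using z(1) q(3) projection_op_in_range_iff[OF q(1)] by fastforce
      then have "blinfun_apply ((P - q) o\<^sub>L t) x =
          blinfun_apply (P - q) (blinfun_apply P (blinfun_apply t x) - blinfun_apply P (blinfun_apply t z))"
        by (simp add: blinfun.diff_left blinfun.diff_right projection_op_apply_idem[OF P] qP)
      also have "norm \<dots> \<le> norm (blinfun_apply P (blinfun_apply t x) - blinfun_apply P (blinfun_apply t z))"
        by (rule projection_op_norm_apply_le[OF diff])
      finally show ?thesis
        using z(2) by simp
    qed
    then show "norm ((P - q) o\<^sub>L t) \<le> \<epsilon>"
      using \<open>\<epsilon> > 0\<close> by (intro norm_blinfun_le_on_unit_sphere) auto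
  qed
qed

text \<open>For \<open>x\<close> in the range of \<open>P - q\<close>, the vector
  \<open>y = t P x\<close> lies close to a net point \<open>z' = t P z\<close>. If \<open>y\<close>
  is also nearly orthogonal to \<open>z'\<close>, then \<open>y\<close> is small. The vectors
  \<open>u z\<close> are the directions that \<open>q\<close> must contain to force this near
  orthogonality.\<close>

lemma compact_op_right_approximation:
  assumes P: "projection_op P" and c: "compact_op (t o\<^sub>L P)" and "\<epsilon> > 0"
  shows "\<exists>B. finite B \<and> B \<subseteq> range (blinfun_apply P) \<and>
    (\<forall>q. projection_op q \<longrightarrow> P o\<^sub>L q = q \<longrightarrow> B \<subseteq> range (blinfun_apply q) \<longrightarrow> norm (t o\<^sub>L (P - q)) \<le> \<epsilon>)"
proof -
  \<comment> \<open>These give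
    \<open>(\<epsilon> / 2)\<^sup>2 + 2 * (\<epsilon>\<^sup>2 / 4)\<close>, that is three quarters
    of \<open>\<epsilon>\<^sup>2\<close>, in the final estimate.\<close>
  have "\<epsilon> / 2 > 0" "\<epsilon>\<^sup>2 / 4 > 0"
    using \<open>\<epsilon> > 0\<close> by auto
  obtain F where F: "finite F"
    "\<And>x. norm x \<le> 1 \<Longrightarrow> \<exists>z\<in>F. norm (blinfun_apply (t o\<^sub>L P) x - blinfun_apply (t o\<^sub>L P) z) < \<epsilon> / 2"
    using compact_op_finite_net[OF c \<open>\<epsilon> / 2 > 0\<close>] by metis
  define f where "f z x = inner (blinfun_apply (t o\<^sub>L P) z) (blinfun_apply (t o\<^sub>L P) x)" for z x
  have "bounded_linear (f z)" for z
    unfolding f_def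
    by (rule bounded_linear_compose[OF bounded_linear_inner_right blinfun.bounded_linear_right])
  then have "\<exists>u. \<forall>x. norm x \<le> 1 \<longrightarrow> inner u x = 0 \<longrightarrow> \<bar>f z x\<bar> \<le> \<epsilon>\<^sup>2 / 4" for z
    using functional_small_on_orthogonal[OF _ \<open>\<epsilon>\<^sup>2 / 4 > 0\<close>] by metis
  then obtain u where u: "\<And>z x. norm x \<le> 1 \<Longrightarrow> inner (u z) x = 0 \<Longrightarrow> \<bar>f z x\<bar> \<le> \<epsilon>\<^sup>2 / 4"
    by metis
  show ?thesis
  proof (intro exI conjI allI impI)
    \<comment> \<open>The generators must lie in the range of \<open>P\<close>. Projecting
      \<open>u z\<close> there costs nothing, since the vectors \<open>x\<close> tested against it
      satisfy \<open>P x = x\<close>.\<close>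
    let ?B = "(\<lambda>z. blinfun_apply P (u z)) ` F"
    show "finite ?B" "?B \<subseteq> range (blinfun_apply P)"
      using F(1) by auto
    fix q assume q: "projection_op q" "P o\<^sub>L q = q" "?B \<subseteq> range (blinfun_apply q)"
    have diff: "projection_op (P - q)"
      using projection_op_diff P q by blast
    have Pq: "blinfun_apply P (blinfun_apply q y) = blinfun_apply q y" for y
      using q(2) by (metis blinfun_apply_blinfun_compose)
    have qP: "blinfun_apply q (blinfun_apply P y) = blinfun_apply q y" for y
      using projection_op_compose_swap[OF q(2) P q(1) q(1)]
      by (metis blinfun_apply_blinfun_compose)
    have "norm (blinfun_apply (t o\<^sub>L (P - q)) v) \<le> \<epsilon>" if v: "norm v = 1" for v
    proof -
      define x where "x = blinfun_apply (P - q) v"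
      have x: "norm x \<le> 1"
        using projection_op_norm_apply_le[OF diff, of v] v by (simp add: x_def)
      have Px: "blinfun_apply P x = x"
        by (simp add: x_def blinfun.diff_left blinfun.diff_right projection_op_apply_idem[OF P] Pq)
      have qx: "blinfun_apply q x = 0"
        by (simp add: x_def blinfun.diff_left blinfun.diff_right projection_op_apply_idem[OF q(1)] qP)
      obtain z where z: "z \<in> F"
        "norm (blinfun_apply (t o\<^sub>L P) x - blinfun_apply (t o\<^sub>L P) z) < \<epsilon> / 2"
        using F(2)[OF x] by blast
      have "inner (u z) x = inner (blinfun_apply P (u z)) x"
        by (simp add: self_adjoint_inner[OF projection_op_self_adjoint[OF P]] Px)
      also have "\<dots> = inner (blinfun_apply q (blinfun_apply P (u z))) x"
        using z(1) q(3) projection_op_in_range_iff[OF q(1)] by fastforce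
      also have "\<dots> = 0"
        by (simp add: self_adjoint_inner[OF projection_op_self_adjoint[OF q(1)]] qx)
      finally have f: "\<bar>f z x\<bar> \<le> \<epsilon>\<^sup>2 / 4"
        using u x by blast
      let ?y = "blinfun_apply (t o\<^sub>L P) x" and ?z = "blinfun_apply (t o\<^sub>L P) z"
      have "(norm (?y - ?z))\<^sup>2 = (norm ?y)\<^sup>2 - 2 * f z x + (norm ?z)\<^sup>2"
        unfolding f_def power2_norm_eq_inner
        by (simp add: inner_diff_left inner_diff_right inner_commute)
      moreover have "(norm (?y - ?z))\<^sup>2 \<le> (\<epsilon> / 2)\<^sup>2"
        using z(2) by (intro power_mono) auto
      ultimately have "(norm ?y)\<^sup>2 \<le> (\<epsilon> / 2)\<^sup>2 + 2 * (\<epsilon>\<^sup>2 / 4)"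
        using f zero_le_power2[of "norm ?z"] by linarith
      also have "\<dots> \<le> \<epsilon>\<^sup>2"
        by (simp add: power_divide)
      finally have "norm ?y \<le> \<epsilon>"
        using \<open>\<epsilon> > 0\<close> by (rule power2_le_imp_le[OF _ less_imp_le])
      then show ?thesis
        by (simp add: Px flip: x_def)
    qed
    then show "norm (t o\<^sub>L (P - q)) \<le> \<epsilon>"
      using \<open>\<epsilon> > 0\<close> by (intro norm_blinfun_le_on_unit_sphere) auto
  qed
qed

section \<open>Selections of finite-dimensional subspaces\<close>

lemma eventually_net_filterI:
  assumes "l \<in> L" "\<And>m. m \<in> L \<Longrightarrow> le l m \<Longrightarrow> P m"
  shows "eventually P (net_filter L le)"
  unfolding net_filter_def
  by (rule eventually_INF1[OF assms(1)]) (simp add: eventually_principal assms(2))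

lemma sum_geometric_weights_le:
  fixes n :: "'i \<Rightarrow> nat"
  assumes "finite F" "inj_on n F"
  shows "(\<Sum>i\<in>F. (1/2::real) ^ Suc (n i)) \<le> 1"
proof -
  have "(\<Sum>i\<in>F. (1/2::real) ^ Suc (n i)) = (\<Sum>k\<in>n ` F. (1/2) ^ Suc k)"
    by (simp add: sum.reindex[OF assms(2)])
  also have "\<dots> \<le> (\<Sum>k. (1/2) ^ Suc k)"
    using assms(1) sums_summable[OF power_half_series] by (intro sum_le_suminf) auto
  also have "\<dots> = 1"
    using power_half_series by (rule sums_unique[symmetric])
  finally show ?thesis .
qed

text \<open>The fibres of a coarse map to a countable space are bounded, so each of them meets only
  finitely many members.\<close>

lemma (in coarse_space) countable_nonempty_members:
  assumes "coarsely_countable X \<E>" "locally_finite_family \<E> I A" "\<And>i. i \<in> I \<Longrightarrow> A i \<subseteq> X"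
  shows "countable {i \<in> I. A i \<noteq> {}}"
proof -
  obtain Y :: "nat set" and f g where f: "f \<in> X \<rightarrow> Y" and D: "{(g (f x), x) |x. x \<in> X} \<in> \<E>"
    using assms(1) unfolding coarsely_countable_def coarsely_equivalent_def by auto
  let ?D = "{(g (f x), x) |x. x \<in> X}" and ?C = "\<lambda>y. {x \<in> X. f x = y}"
  have "coarsely_bounded \<E> (?C y)" for y
    unfolding coarsely_bounded_def
  proof (rule subset_closed)
    \<comment> \<open>Two points of one fibre of \<open>f\<close> are both close to their common
      image under \<open>g \<circ> f\<close>, so one step there and one step back joins
      them.\<close>
    show "?D\<inverse> O ?D \<in> \<E>"
      by (rule comp_closed[OF transpose_closed[OF D] D])
    show "?C y \<times> ?C y \<subseteq> ?D\<inverse> O ?D"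
    proof
      fix z assume "z \<in> ?C y \<times> ?C y"
      then obtain x x' where z: "z = (x, x')" "x \<in> X" "x' \<in> X" "f x = f x'"
        by auto
      have "(x, g (f x)) \<in> ?D\<inverse>"
        using z(2) by blast
      moreover have "(g (f x), x') \<in> ?D"
        unfolding z(4) using z(3) by blast
      ultimately show "z \<in> ?D\<inverse> O ?D"
        unfolding z(1) by (rule relcompI)
    qed
  qed
  then have "finite {i \<in> I. A i \<inter> ?C y \<noteq> {}}" for y
    using assms(2) unfolding locally_finite_family_def by simp
  then have "countable (\<Union>y\<in>Y. {i \<in> I. A i \<inter> ?C y \<noteq> {}})"
    by (rule countable_UN[OF countableI_type countable_finite])
  moreover have "{i \<in> I. A i \<noteq> {}} \<subseteq> (\<Union>y\<in>Y. {i \<in> I. A i \<inter> ?C y \<noteq> {}})"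
  proof
    fix i assume "i \<in> {i \<in> I. A i \<noteq> {}}"
    then obtain x where x: "i \<in> I" "x \<in> A i"
      by blast
    then have "x \<in> X"
      using assms(3) by blast
    with x show "i \<in> (\<Union>y\<in>Y. {i \<in> I. A i \<inter> ?C y \<noteq> {}})"
      using f by (intro UN_I[of "f x"]) auto
  qed
  ultimately show ?thesis
    by (rule countable_subset[rotated])
qed

lemma
  assumes "l \<in> fd_selections ind I A" "i \<in> I"
  shows fd_selections_finite_dim: "finite_dim_csubspace (l i)"
    and fd_selections_subset: "l i \<subseteq> range (blinfun_apply (ind (A i)))"
  using PiE_mem[OF assms(1)[unfolded fd_selections_def] assms(2)] by simp_all

lemmas projection_selection = projection_orth_proj[OF fd_selections_finite_dim]
lemmas compact_selection = compact_orth_proj[OF fd_selections_finite_dim]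

section \<open>The directed set of selections\<close>

context coarse_module
begin

lemma span_selection:
  assumes "\<And>i. i \<in> I \<Longrightarrow> A i \<in> \<AA>" "\<And>i. i \<in> I \<Longrightarrow> finite (B i)"
    "\<And>i. i \<in> I \<Longrightarrow> B i \<subseteq> range (blinfun_apply (ind (A i)))"
  shows "(\<lambda>i\<in>I. cspan (B i)) \<in> fd_selections ind I A"
  unfolding fd_selections_def
proof (rule restrict_PiE_iff[THEN iffD2], rule ballI, rule CollectI, rule conjI)
  fix i assume i: "i \<in> I"
  show "finite_dim_csubspace (cspan (B i))"
    unfolding finite_dim_csubspace_def using assms(2)[OF i] by (intro exI[of _ "B i"]) simp
  show "cspan (B i) \<subseteq> range (blinfun_apply (ind (A i)))"
    by (rule cvec.span_minimal[OF assms(3)[OF i]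
          subspace_range_projection[OF ind_projection[OF assms(1)[OF i]]]])
qed

lemma selection_span:
  assumes "l \<in> fd_selections ind I A"
  shows "\<exists>B. \<forall>i\<in>I. finite (B i) \<and> B i \<subseteq> range (blinfun_apply (ind (A i))) \<and> l i = cspan (B i)"
proof -
  have "\<forall>i\<in>I. \<exists>B. finite B \<and> l i = cspan B"
    using fd_selections_finite_dim[OF assms] unfolding finite_dim_csubspace_def by blast
  then obtain B where B: "\<forall>i\<in>I. finite (B i) \<and> l i = cspan (B i)"
    by (rule bchoice[THEN exE])
  show ?thesis
  proof (intro exI ballI conjI)
    fix i assume i: "i \<in> I"
    with B show "finite (B i)" "l i = cspan (B i)"
      by auto
    then show "B i \<subseteq> range (blinfun_apply (ind (A i)))"
      using fd_selections_subset[OF assms i] cvec.span_superset[of "B i"] by simp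
  qed
qed

lemma directed_selections:
  assumes "\<And>i. i \<in> I \<Longrightarrow> A i \<in> \<AA>"
  shows "directed_by (fd_selections ind I A) (selection_le I)"
  unfolding directed_by_def
proof (intro conjI ballI impI)
  show "fd_selections ind I A \<noteq> {}"
    using span_selection[of I A "\<lambda>_. {}", OF assms] by auto
  fix l assume l: "l \<in> fd_selections ind I A"
  show "selection_le I l l"
    by (simp add: selection_le_def)
  fix m assume m: "m \<in> fd_selections ind I A"
  show "selection_le I l n" if "selection_le I l m" "selection_le I m n" for n
    using that unfolding selection_le_def by (auto dest!: bspec)
  obtain B where B: "\<forall>i\<in>I. finite (B i) \<and> B i \<subseteq> range (blinfun_apply (ind (A i))) \<and> l i = cspan (B i)"
    by (rule exE[OF selection_span[OF l]])
  obtain C where C: "\<forall>i\<in>I. finite (C i) \<and> C i \<subseteq> range (blinfun_apply (ind (A i))) \<and> m i = cspan (C i)"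
    by (rule exE[OF selection_span[OF m]])
  \<comment> \<open>This is the sum of the two subspaces, written with finite generating sets so
    that it is visibly finite-dimensional.\<close>
  let ?n = "\<lambda>i\<in>I. cspan (B i \<union> C i)"
  have "?n \<in> fd_selections ind I A"
    using B C by (intro span_selection assms) simp_all
  moreover have "selection_le I l ?n" "selection_le I m ?n"
    using B C by (simp_all add: selection_le_def cvec.span_mono)
  ultimately show "\<exists>n\<in>fd_selections ind I A. selection_le I l n \<and> selection_le I m n"
    by (intro bexI[of _ ?n] conjI)
qed

section \<open>Projections attached to selections of a discrete partition\<close>

context
  fixes I :: "'i set" and A :: "'i \<Rightarrow> 'x set"
  assumes part: "discrete_partition X \<E> \<AA> ind I A"
begin

lemma measurable_member: "i \<in> I \<Longrightarrow> A i \<in> \<AA>"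
  using part unfolding discrete_partition_def by simp

lemma bounded_member:
  assumes "i \<in> I"
  shows "coarsely_bounded \<E> (A i)"
proof -
  obtain E where "gauge_rel X \<E> E" "\<forall>i\<in>I. rel_bounded E (A i)"
    using part unfolding discrete_partition_def by (elim conjE exE)
  then show ?thesis
    using assms subset_closed[of E] unfolding gauge_rel_def rel_bounded_def coarsely_bounded_def
    by simp
qed

lemma projection_member: "i \<in> I \<Longrightarrow> projection_op (ind (A i))"
  by (rule ind_projection[OF measurable_member])

lemma member_selection:
  assumes "l \<in> fd_selections ind I A" "i \<in> I"
  shows "ind (A i) o\<^sub>L orth_proj (l i) = orth_proj (l i)"
  using fd_selections_subset[OF assms]
  by (simp add: projection_op_compose_eq_iff[OF projection_member[OF assms(2)]]
      range_orth_proj[OF fd_selections_finite_dim[OF assms]])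

lemma selection_member:
  assumes "l \<in> fd_selections ind I A" "i \<in> I"
  shows "orth_proj (l i) o\<^sub>L ind (A i) = orth_proj (l i)"
  using member_selection[OF assms] projection_member[OF assms(2)] projection_selection[OF assms]
    projection_selection[OF assms]
  by (rule projection_op_compose_swap)

text \<open>Only the part of \<open>B\<close> inside \<open>A i\<close> is seen by
  \<open>orth_proj (l i)\<close>, so both products vanish when \<open>B\<close> misses
  \<open>A i\<close>. Orthogonality, local compactness and controlled propagation all rest on
  this.\<close>

lemma ind_selection:
  assumes "l \<in> fd_selections ind I A" "i \<in> I" "B \<in> \<AA>"
  shows "ind B o\<^sub>L orth_proj (l i) = ind (B \<inter> A i) o\<^sub>L orth_proj (l i)"
    and "orth_proj (l i) o\<^sub>L ind B = orth_proj (l i) o\<^sub>L ind (A i \<inter> B)"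
  by (simp_all only: ind_inter[OF assms(3) measurable_member[OF assms(2)]]
      ind_inter[OF measurable_member[OF assms(2)] assms(3)]
      blinfun_compose_assoc member_selection[OF assms(1,2)])
    (simp only: blinfun_compose_assoc[symmetric] selection_member[OF assms(1,2)])

lemma selection_orthogonal:
  assumes "l \<in> fd_selections ind I A" "m \<in> fd_selections ind I A" "i \<in> I" "j \<in> I" "i \<noteq> j"
  shows "orth_proj (l i) o\<^sub>L orth_proj (m j) = 0"
proof -
  have "A i \<inter> A j = {}"
    using part assms(3-5) unfolding discrete_partition_def indexed_partition_def
    by (auto simp: disjoint_family_on_def)
  then have "orth_proj (l i) o\<^sub>L ind (A j) = 0"
    using ind_selection(2)[OF assms(1,3) measurable_member[OF assms(4)]]
    by (simp add: ind_empty)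
  then show ?thesis
    using member_selection[OF assms(2,4)]
    by (metis blinfun_compose_assoc blinfun_compose_zero(1))
qed

lemma
  assumes l: "l \<in> fd_selections ind I A"
  shows strong_sum_selection: "has_strong_sum (\<lambda>i. orth_proj (l i)) I (selection_proj I l)"
    and projection_selection_proj: "projection_op (selection_proj I l)"
proof -
  have "\<exists>s. has_strong_sum (\<lambda>i. orth_proj (l i)) I s \<and> projection_op s"
    by (rule orthogonal_strong_sum) (simp_all add: projection_selection[OF l] selection_orthogonal[OF l l])
  then obtain s where s: "has_strong_sum (\<lambda>i. orth_proj (l i)) I s" "projection_op s"
    by (elim exE conjE)
  have "selection_proj I l = s"
    unfolding selection_proj_def strong_sum_def
    using s(1) has_strong_sum_unique[OF _ s(1)] by (rule the_equality)
  with s show "has_strong_sum (\<lambda>i. orth_proj (l i)) I (selection_proj I l)"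
    "projection_op (selection_proj I l)"
    by simp_all
qed

text \<open>This is monotonicity of the net: it makes the difference of the two projections a
  projection, hence positive. Against \<open>orth_proj (l i)\<close> only the term
  \<open>j = i\<close> survives, where \<open>l i \<subseteq> m i\<close> applies.\<close>

lemma selection_proj_absorb:
  assumes l: "l \<in> fd_selections ind I A" and m: "m \<in> fd_selections ind I A"
    and le: "selection_le I l m"
  shows "selection_proj I m o\<^sub>L selection_proj I l = selection_proj I l"
proof -
  have "selection_proj I m o\<^sub>L orth_proj (l i) = orth_proj (l i)" if i: "i \<in> I" for i
  proof -
    have "has_strong_sum (\<lambda>j. orth_proj (m j) o\<^sub>L orth_proj (l i)) I
        (\<Sum>j\<in>{i}. orth_proj (m j) o\<^sub>L orth_proj (l i))"
      using i selection_orthogonal[OF m l _ i] by (intro has_strong_sum_finite_support) auto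
    then have "selection_proj I m o\<^sub>L orth_proj (l i) = (\<Sum>j\<in>{i}. orth_proj (m j) o\<^sub>L orth_proj (l i))"
      by (rule has_strong_sum_unique[OF has_strong_sum_compose_right[OF strong_sum_selection[OF m]]])
    also have "\<dots> = orth_proj (m i) o\<^sub>L orth_proj (l i)"
      by simp
    also have "\<dots> = orth_proj (l i)"
      using le i
      by (simp add: projection_op_compose_eq_iff[OF projection_selection[OF m i]] selection_le_def
          range_orth_proj[OF fd_selections_finite_dim[OF l i]]
          range_orth_proj[OF fd_selections_finite_dim[OF m i]])
    finally show ?thesis .
  qed
  then have "has_strong_sum (\<lambda>i. selection_proj I m o\<^sub>L orth_proj (l i)) I (selection_proj I l)
      \<longleftrightarrow> has_strong_sum (\<lambda>i. orth_proj (l i)) I (selection_proj I l)"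
    by (rule has_strong_sum_cong)
  then have "has_strong_sum (\<lambda>i. selection_proj I m o\<^sub>L orth_proj (l i)) I (selection_proj I l)"
    using strong_sum_selection[OF l] by (rule iffD2)
  then show ?thesis
    by (rule has_strong_sum_unique[OF has_strong_sum_compose_left[OF strong_sum_selection[OF l]]])
qed

text \<open>A bounded set meets only finitely many members, so cutting down to it leaves a finite
  sum of compact operators.\<close>

lemma locally_compact_selection_proj:
  assumes l: "l \<in> fd_selections ind I A" and lf: "locally_finite_family \<E> I A"
  shows "locally_compact_op \<E> \<AA> ind (selection_proj I l)"
  unfolding locally_compact_op_def
proof (intro ballI impI)
  fix B assume B: "B \<in> \<AA>" and "coarsely_bounded \<E> B"
  define F where "F = {i \<in> I. A i \<inter> B \<noteq> {}}"
  have F: "finite F" "F \<subseteq> I"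
    using lf \<open>coarsely_bounded \<E> B\<close> unfolding locally_finite_family_def F_def by auto
  have "i \<in> I \<and> A i \<inter> B = {} \<and> B \<inter> A i = {}" if "i \<in> I - F" for i
    using that by (auto simp: F_def)
  then have zero: "ind B o\<^sub>L orth_proj (l i) = 0" "orth_proj (l i) o\<^sub>L ind B = 0" if "i \<in> I - F" for i
    using that ind_selection[OF l _ B, of i] by (simp_all add: ind_empty)
  have comp: "compact_op (ind B o\<^sub>L orth_proj (l i))" "compact_op (orth_proj (l i) o\<^sub>L ind B)"
    if "i \<in> F" for i
    using compact_selection[OF l] that F(2)
    by (auto intro: compact_op_compose_left compact_op_compose_right)
  have "ind B o\<^sub>L selection_proj I l = (\<Sum>i\<in>F. ind B o\<^sub>L orth_proj (l i))"
    by (rule has_strong_sum_unique[OF has_strong_sum_compose_left[OF strong_sum_selection[OF l]]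
          has_strong_sum_finite_support[OF F zero(1)]])
  moreover have "selection_proj I l o\<^sub>L ind B = (\<Sum>i\<in>F. orth_proj (l i) o\<^sub>L ind B)"
    by (rule has_strong_sum_unique[OF has_strong_sum_compose_right[OF strong_sum_selection[OF l]]
          has_strong_sum_finite_support[OF F zero(2)]])
  ultimately show "compact_op (ind B o\<^sub>L selection_proj I l) \<and> compact_op (selection_proj I l o\<^sub>L ind B)"
    by (simp add: compact_op_sum comp)
qed

text \<open>The common bound \<open>E\<close> of the members controls the propagation: if
  \<open>B\<close> and \<open>C\<close> both met \<open>A i\<close>, a pair in
  \<open>A i \<times> A i \<subseteq> E\<close> would contradict separation. So every term of the
  sum vanishes.\<close>

lemma controlled_propagation_selection_proj:
  assumes l: "l \<in> fd_selections ind I A"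
  shows "controlled_propagation \<E> \<AA> ind (selection_proj I l)"
proof -
  obtain E where E: "gauge_rel X \<E> E" "\<forall>i\<in>I. rel_bounded E (A i)"
    using part unfolding discrete_partition_def by (elim conjE exE)
  have "ind B o\<^sub>L selection_proj I l o\<^sub>L ind C = 0"
    if BC: "B \<in> \<AA>" "C \<in> \<AA>" "separated E B C" for B C
  proof -
    have "ind B o\<^sub>L orth_proj (l i) o\<^sub>L ind C = 0" if i: "i \<in> I" for i
    proof (cases "B \<inter> A i = {}")
      case True
      then show ?thesis
        using ind_selection(1)[OF l i BC(1)] by (simp add: ind_empty)
    next
      case False
      then have "A i \<inter> C = {}"
        using E(2) i BC(3) unfolding separated_def rel_bounded_def by fastforce
      then have "orth_proj (l i) o\<^sub>L ind C = 0"
        using ind_selection(2)[OF l i BC(2)] by (simp add: ind_empty)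
      then show ?thesis
        by (simp add: blinfun_compose_assoc)
    qed
    then have "has_strong_sum (\<lambda>i. ind B o\<^sub>L orth_proj (l i) o\<^sub>L ind C) I (\<Sum>i\<in>{}. ind B o\<^sub>L orth_proj (l i) o\<^sub>L ind C)"
      by (intro has_strong_sum_finite_support) auto
    then have "has_strong_sum (\<lambda>i. ind B o\<^sub>L orth_proj (l i) o\<^sub>L ind C) I 0"
      by simp
    then show ?thesis
      by (rule has_strong_sum_unique[OF has_strong_sum_compose_right[OF
              has_strong_sum_compose_left[OF strong_sum_selection[OF l]]]])
  qed
  then show ?thesis
    using E(1) unfolding controlled_propagation_def gauge_rel_def by (intro bexI[of _ E]) auto
qed

text \<open>The error allowed on the members of the partition is summable over the countably many nonempty
  ones; the empty ones contribute nothing.\<close>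

lemma selection_proj_approximation:
  assumes cc: "coarsely_countable X \<E>" and lf: "locally_finite_family \<E> I A"
    and t: "t \<in> C_lc \<E> \<AA> ind" and "\<epsilon> > 0"
  shows "\<exists>l\<in>fd_selections ind I A. \<forall>m\<in>fd_selections ind I A. selection_le I l m \<longrightarrow>
      norm (t - (selection_proj I m o\<^sub>L t)) \<le> \<epsilon> \<and> norm (t - (t o\<^sub>L selection_proj I m)) \<le> \<epsilon>"
proof -
  define J where "J = {i \<in> I. A i \<noteq> {}}"
  have "A i \<subseteq> X" if "i \<in> I" for i
    using part that unfolding discrete_partition_def indexed_partition_def by auto
  then have "countable J"
    unfolding J_def by (rule countable_nonempty_members[OF cc lf])
  then have inj: "inj_on (to_nat_on J) J"
    by (rule inj_on_to_nat_on)
  \<comment> \<open>The exponent starts at 1, so distinct indices in \<open>J\<close> contribute at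
    most \<epsilon> in total. The value is positive for every \<open>i\<close>, as the approximation
    lemmas require.\<close>
  define e where "e i = \<epsilon> * (1/2) ^ Suc (to_nat_on J i)" for i
  have e: "e i > 0" for i
    using \<open>\<epsilon> > 0\<close> by (simp add: e_def)
  have "\<exists>B. finite B \<and> B \<subseteq> range (blinfun_apply (ind (A i))) \<and>
      (\<forall>q. projection_op q \<longrightarrow> ind (A i) o\<^sub>L q = q \<longrightarrow> B \<subseteq> range (blinfun_apply q) \<longrightarrow>
        norm ((ind (A i) - q) o\<^sub>L t) \<le> e i \<and> norm (t o\<^sub>L (ind (A i) - q)) \<le> e i)"
    if i: "i \<in> I" for i
  proof -
    have c: "compact_op (ind (A i) o\<^sub>L t)" "compact_op (t o\<^sub>L ind (A i))"
      using t measurable_member[OF i] bounded_member[OF i]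
      unfolding C_lc_def locally_compact_op_def by auto
    obtain B where B: "finite B \<and> B \<subseteq> range (blinfun_apply (ind (A i))) \<and>
      (\<forall>q. projection_op q \<longrightarrow> ind (A i) o\<^sub>L q = q \<longrightarrow> B \<subseteq> range (blinfun_apply q) \<longrightarrow>
        norm ((ind (A i) - q) o\<^sub>L t) \<le> e i)"
      by (rule exE[OF compact_op_left_approximation[OF projection_member[OF i] c(1) e[of i]]])
    obtain C where C: "finite C \<and> C \<subseteq> range (blinfun_apply (ind (A i))) \<and>
      (\<forall>q. projection_op q \<longrightarrow> ind (A i) o\<^sub>L q = q \<longrightarrow> C \<subseteq> range (blinfun_apply q) \<longrightarrow>
        norm (t o\<^sub>L (ind (A i) - q)) \<le> e i)"
      by (rule exE[OF compact_op_right_approximation[OF projection_member[OF i] c(2) e[of i]]])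
    show ?thesis
      \<comment> \<open>Each estimate persists when the range of \<open>q\<close> grows, so the
        union of the generators serves both sides.\<close>
      using B C by (intro exI[of _ "B \<union> C"]) simp
  qed
  then have "\<forall>i\<in>I. \<exists>B. finite B \<and> B \<subseteq> range (blinfun_apply (ind (A i))) \<and>
      (\<forall>q. projection_op q \<longrightarrow> ind (A i) o\<^sub>L q = q \<longrightarrow> B \<subseteq> range (blinfun_apply q) \<longrightarrow>
        norm ((ind (A i) - q) o\<^sub>L t) \<le> e i \<and> norm (t o\<^sub>L (ind (A i) - q)) \<le> e i)"
    by (rule ballI)
  then obtain B where B: "\<forall>i\<in>I. finite (B i) \<and> B i \<subseteq> range (blinfun_apply (ind (A i))) \<and>
      (\<forall>q. projection_op q \<longrightarrow> ind (A i) o\<^sub>L q = q \<longrightarrow> B i \<subseteq> range (blinfun_apply q) \<longrightarrow>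
        norm ((ind (A i) - q) o\<^sub>L t) \<le> e i \<and> norm (t o\<^sub>L (ind (A i) - q)) \<le> e i)"
    by (rule bchoice[THEN exE])
  let ?l = "\<lambda>i\<in>I. cspan (B i)"
  show ?thesis
  proof (rule bexI[of _ ?l], intro ballI impI)
    show "?l \<in> fd_selections ind I A"
      using B by (intro span_selection measurable_member) auto
    fix m assume m: "m \<in> fd_selections ind I A" and le: "selection_le I ?l m"
    define d where "d i = ind (A i) - orth_proj (m i)" for i
    \<comment> \<open>Outside \<open>J\<close> the numbering need not be injective and
      \<open>e\<close> need not have bounded sums. There \<open>ind (A i)\<close> is zero, so the
      error \<open>d i\<close> is zero as well.\<close>
    define e' where "e' i = (if A i = {} then 0 else e i)" for i
    have d: "norm (d i o\<^sub>L t) \<le> e' i \<and> norm (t o\<^sub>L d i) \<le> e' i" if i: "i \<in> I" for i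
    proof (cases "A i = {}")
      case True
      then have "d i = 0"
        using member_selection[OF m i] by (simp add: d_def ind_empty)
      then show ?thesis
        by (simp add: e'_def True)
    next
      case False
      have "B i \<subseteq> range (blinfun_apply (orth_proj (m i)))"
        using le i cvec.span_superset[of "B i"]
        by (auto simp: selection_le_def range_orth_proj[OF fd_selections_finite_dim[OF m i]])
      then show ?thesis
        using B[rule_format, OF i] projection_selection[OF m i] member_selection[OF m i] False
        by (simp add: d_def e'_def)
    qed
    have sum: "sum e' F \<le> \<epsilon>" if F: "finite F" "F \<subseteq> I" for F
    proof -
      have "sum e' F = sum e (F \<inter> J)"
        unfolding sum.inter_restrict[OF F(1)] using F(2) by (intro sum.cong) (auto simp: e'_def J_def)
      also have "\<dots> = \<epsilon> * (\<Sum>i\<in>F \<inter> J. (1/2) ^ Suc (to_nat_on J i))"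
        by (simp add: e_def sum_distrib_left del: power_Suc)
      also have "\<dots> \<le> \<epsilon> * 1"
        using \<open>\<epsilon> > 0\<close> F(1) inj_on_subset[OF inj]
        by (intro mult_left_mono sum_geometric_weights_le) auto
      finally show ?thesis
        by simp
    qed
    \<comment> \<open>Since the members sum strongly to the identity, the whole defect
      \<open>1 - p\<close> splits into the local defects \<open>d i\<close>.\<close>
    have "has_strong_sum (\<lambda>i. ind (A i)) I id_blinfun"
      using part unfolding discrete_partition_def by simp
    then have d_sum: "has_strong_sum d I (id_blinfun - selection_proj I m)"
      unfolding d_def by (rule has_strong_sum_diff[OF _ strong_sum_selection[OF m]])
    have "norm ((id_blinfun - selection_proj I m) o\<^sub>L t) \<le> \<epsilon>"
      using has_strong_sum_compose_right[OF d_sum] conjunct1[OF d] less_imp_le[OF \<open>\<epsilon> > 0\<close>] sum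
      by (rule has_strong_sum_norm_le)
    moreover have "norm (t o\<^sub>L (id_blinfun - selection_proj I m)) \<le> \<epsilon>"
      using has_strong_sum_compose_left[OF d_sum] conjunct2[OF d] less_imp_le[OF \<open>\<epsilon> > 0\<close>] sum
      by (rule has_strong_sum_norm_le)
    moreover have "(id_blinfun - selection_proj I m) o\<^sub>L t = t - (selection_proj I m o\<^sub>L t)"
      "t o\<^sub>L (id_blinfun - selection_proj I m) = t - (t o\<^sub>L selection_proj I m)"
      by (auto intro!: blinfun_eqI simp: blinfun.diff_left blinfun.diff_right)
    ultimately show "norm (t - (selection_proj I m o\<^sub>L t)) \<le> \<epsilon> \<and> norm (t - (t o\<^sub>L selection_proj I m)) \<le> \<epsilon>"
      by simp
  qed
qed

lemma approximate_unit_selection_proj: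
  assumes cc: "coarsely_countable X \<E>" and lf: "locally_finite_family \<E> I A"
  shows "approximate_unit (C_lc \<E> \<AA> ind) (fd_selections ind I A) (selection_le I) (selection_proj I)"
  unfolding approximate_unit_def
proof (intro conjI ballI impI)
  show "directed_by (fd_selections ind I A) (selection_le I)"
    by (rule directed_selections[OF measurable_member])
  fix l assume l: "l \<in> fd_selections ind I A"
  show "selection_proj I l \<in> C_lc \<E> \<AA> ind"
    unfolding C_lc_def
    using projection_op_bounded[OF projection_selection_proj[OF l]]
      locally_compact_selection_proj[OF l lf] by simp
  show "positive_op (selection_proj I l)"
    by (rule positive_projection[OF projection_selection_proj[OF l]])
  show "norm (selection_proj I l) \<le> 1"
    by (rule projection_op_norm_le[OF projection_selection_proj[OF l]])
  fix m assume m: "m \<in> fd_selections ind I A" "selection_le I l m"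
  show "positive_op (selection_proj I m - selection_proj I l)"
    by (rule positive_projection[OF projection_op_diff[OF projection_selection_proj[OF m(1)]
            projection_selection_proj[OF l] selection_proj_absorb[OF l m]]])
next
  fix t assume t: "t \<in> C_lc \<E> \<AA> ind"
  have ev: "\<forall>\<^sub>F l in net_filter (fd_selections ind I A) (selection_le I).
      dist (selection_proj I l o\<^sub>L t) t < \<epsilon> \<and> dist (t o\<^sub>L selection_proj I l) t < \<epsilon>" if pos: "\<epsilon> > 0" for \<epsilon>
  proof -
    obtain l where l: "l \<in> fd_selections ind I A"
      "\<forall>m\<in>fd_selections ind I A. selection_le I l m \<longrightarrow>
        norm (t - (selection_proj I m o\<^sub>L t)) \<le> \<epsilon> / 2 \<and> norm (t - (t o\<^sub>L selection_proj I m)) \<le> \<epsilon> / 2"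
      \<comment> \<open>Half of \<epsilon> turns the weak inequality of the approximation into the
        strict one needed for the limit.\<close>
      by (rule bexE[OF selection_proj_approximation[OF cc lf t half_gt_zero[OF pos]]])
    show ?thesis
      using l(1)
    proof (rule eventually_net_filterI)
      fix m assume "m \<in> fd_selections ind I A" "selection_le I l m"
      then show "dist (selection_proj I m o\<^sub>L t) t < \<epsilon> \<and> dist (t o\<^sub>L selection_proj I m) t < \<epsilon>"
        using l(2)[rule_format, of m] pos by (simp add: dist_norm norm_minus_commute[of _ t])
    qed
  qed
  show "((\<lambda>l. selection_proj I l o\<^sub>L t) \<longlongrightarrow> t) (net_filter (fd_selections ind I A) (selection_le I))"
    by (rule tendstoI) (rule eventually_mono[OF ev], assumption, erule conjunct1)
  show "((\<lambda>l. t o\<^sub>L selection_proj I l) \<longlongrightarrow> t) (net_filter (fd_selections ind I A) (selection_le I))"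
    by (rule tendstoI) (rule eventually_mono[OF ev], assumption, erule conjunct2)
qed

end

end

theorem proposition6p21:
  fixes X :: "'x set" and \<E> :: "('x \<times> 'x) set set" and \<AA> :: "'x set set"
    and ind :: "'x set \<Rightarrow> ('h::complex_hilbert_space \<Rightarrow>\<^sub>L 'h)"
    and I :: "'i set" and A :: "'i \<Rightarrow> 'x set"
  assumes "coarse_space X \<E>"
    and "coarsely_locally_finite X \<E>"
    and "coarsely_countable X \<E>"
    and "coarse_module X \<E> \<AA> ind"
    and "discrete_module X \<E> \<AA> ind"
    and "discrete_partition X \<E> \<AA> ind I A"
    and "locally_finite_family \<E> I A"
  shows "(\<forall>l \<in> fd_selections ind I A.
            has_strong_sum (\<lambda>i. orth_proj (l i)) I (selection_proj I l)) \<and>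
         selection_proj I ` fd_selections ind I A \<subseteq> C_Roe \<E> \<AA> ind \<and>
         approximate_unit (C_lc \<E> \<AA> ind) (fd_selections ind I A) (selection_le I) (selection_proj I)"
proof -
  interpret coarse_module X \<E> \<AA> ind by fact
  have "selection_proj I l \<in> C_Roe \<E> \<AA> ind" if l: "l \<in> fd_selections ind I A" for l
    unfolding C_Roe_def
    using projection_op_bounded[OF projection_selection_proj[OF assms(6) l]]
      locally_compact_selection_proj[OF assms(6) l assms(7)]
      controlled_propagation_selection_proj[OF assms(6) l] by simp
  then show ?thesis
    using strong_sum_selection[OF assms(6)] approximate_unit_selection_proj[OF assms(6) assms(3) assms(7)]
    by (intro conjI ballI image_subsetI)
qed

end
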